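(* Let $A\in\mathbb{Q}_{\mathbb{R}}^{m\times n}$, $B\in\mathbb{Q}_{\mathbb{R}}^{m\times d}$, $C\in\mathbb{Q}_{\mathbb{R}}^{p\times n}$, $D\in\mathbb{Q}_{\mathbb{R}}^{p\times d}$ with $m\ge n+d$ and $C^C_c$ of full row rank. Let $X_{CL}$ be the complex solution of the RBLSE problem $$\min_{X\in\mathbb{C}^{n\times d}}\|AX-B\|_F\quad\text{subject to}\quad CX=D.$$ Let $\widehat A=A+\Delta A$, $\widehat B=B+\Delta B$, $\widehat C=C+\Delta C$, $\widehat D=D+\Delta D$ be perturbed data (over $\mathbb{Q}_{\mathbb{R}}$, of the same sizes), where the perturbations are small enough that $\widehat C^C_c$ retains full row rank, and let $\epsilon$ be the smallest number for which $$\|\Delta A\|_F\le\epsilon\|A\|_F,\quad \|\Delta B\|_F\le\epsilon\|B\|_F,\quad \|\Delta C\|_F\le\epsilon\|C\|_F,\quad \|\Delta D\|_F\le\epsilon\|D\|_F.$$ Let $\widehat X_{CL}$ be the complex solution of the perturbed RBLSE problem $$\min_{X\in\mathbb{C}^{n\times d}}\|\widehat AX-\widehat B\|_F\quad\text{subject to}\quad \widehat CX=\widehat D,$$ and let $\Delta X_{CL}=\widehat X_{CL}-X_{CL}$. If the perturbations $\Delta A,\Delta B,\Delta C,\Delta D$ are sufficiently small, then $$\begin{aligned}\frac{\|\Delta X_{CL}\|_F}{\|X_{CL}\|_F}\le{}&\epsilon\Biggl(\mathcal{K}_A^C\Bigl(\frac{\|D^C_c\|_F}{\|C^C_c\|_F\|X_{CL}\|_F}+1\Bigr)+\mathcal{K}_B^C\Bigl(\frac{\|B^C_c\|_F}{\|A^C_c\|_F\|X_{CL}\|_F}+1\Bigr)\\&\quad+(\mathcal{K}_B^C)^2\Bigl(\frac{\|C^C_c\|_F}{\|A^C_c\|_F}\|A^C_c\mathcal{L}_c\|_2+1\Bigr)\frac{\|R_c\|_F}{\|A^C_c\|_F\|X_{CL}\|_F}\Biggr)+O(\epsilon^2),\end{aligned}$$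 where $$\mathcal{K}_B^C=\|A^C_c\|_F\,\|(A^C_cP_c)^{\dagger}\|_2,\qquad \mathcal{K}_A^C=\|C^C_c\|_F\,\|\mathcal{L}_c\|_2,\qquad \mathcal{L}_c=\bigl(I_n-(A^C_cP_c)^{\dagger}A^C_c\bigr)(C^C_c)^{\dagger},$$ $$P_c=I_n-(C^C_c)^{\dagger}C^C_c,\qquad R_c=B^C_c-A^C_cX_{CL}.$$
   Context: Reduced biquaternions: $\mathbb{Q}_{\mathbb{R}}$ is the set of elements $\zeta=p_0+p_1\mathbf{i}+p_2\mathbf{j}+p_3\mathbf{k}$ with $p_l\in\mathbb{R}$, with commutative multiplication given by $\mathbf{i}^2=\mathbf{k}^2=-1$, $\mathbf{j}^2=1$, $\mathbf{i}\mathbf{j}=\mathbf{j}\mathbf{i}=\mathbf{k}$, $\mathbf{j}\mathbf{k}=\mathbf{k}\mathbf{j}=\mathbf{i}$, $\mathbf{k}\mathbf{i}=\mathbf{i}\mathbf{k}=-\mathbf{j}$. Equivalently $\zeta=r_1+r_2\mathbf{j}$ with $r_1=p_0+p_1\mathbf{i}$, $r_2=p_2+p_3\mathbf{i}\in\mathbb{C}$ (the complex imaginary unit is identified with $\mathbf{i}$). The norm is $\|\zeta\|=\sqrt{p_0^2+p_1^2+p_2^2+p_3^2}=\sqrt{|r_1|^2+|r_2|^2}$. $\mathbb{Q}_{\mathbb{R}}^{m\times n}$ is the set of $m\times n$ matrices over $\mathbb{Q}_{\mathbb{R}}$; complex matrices are regarded as elements of it. For $M=(m_{st})\in\mathbb{Q}_{\mathbb{R}}^{m\times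 n}$ the Frobenius norm is $\|M\|_F=\sqrt{\sum_{s,t}\|m_{st}\|^2}$; for complex matrices $\|\cdot\|_F$ is the usual Frobenius norm, and $\|\cdot\|_2$ is the matrix $2$-norm (spectral norm). For $M=L_1+L_2\mathbf{j}\in\mathbb{Q}_{\mathbb{R}}^{m\times n}$ with $L_1,L_2\in\mathbb{C}^{m\times n}$, define $M^C_c=[L_1^T,L_2^T]^T\in\mathbb{C}^{2m\times n}$ (the first block column of the complex representation of $M$). RBLSE stands for reduced biquaternion equality constrained least squares. "The complex solution" of an RBLSE problem is its unique complex minimizer of minimum Frobenius norm. $P^{\dagger}$ denotes the Moore–Penrose inverse and $I_n$ the identity matrix. $O(\epsilon^2)$ is understood as $\epsilon\to0$ with $A,B,C,D$ fixed.
   Formalization: The formal theorem additionally assumes that the perturbed product of A-hat_c and P-hat_c has the same rank as A_c P_c; without this the bound fails for small perturbations when A_c and C_c have a common kernel. *)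

theory Defs
  imports "HOL-Analysis.Analysis" "HOL-Library.Landau_Symbols"
begin

section \<open>Reduced biquaternions\<close>

text \<open>
  The reduced biquaternion \<open>p\<^sub>0 + p\<^sub>1 i + p\<^sub>2 j + p\<^sub>3 k\<close> is \<open>RBQ p\<^sub>0 p\<^sub>1 p\<^sub>2 p\<^sub>3\<close>.
\<close>

datatype rbq = RBQ (rbq_re: real) (rbq_i: real) (rbq_j: real) (rbq_k: real)

instantiation rbq :: comm_ring_1
begin

definition zero_rbq :: rbq where "0 = RBQ 0 0 0 0"

definition one_rbq :: rbq where "1 = RBQ 1 0 0 0"

definition plus_rbq :: "rbq \<Rightarrow> rbq \<Rightarrow> rbq" where
  "x + y = RBQ (rbq_re x + rbq_re y) (rbq_i x + rbq_i y) (rbq_j x + rbq_j y) (rbq_k x + rbq_k y)"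

definition uminus_rbq :: "rbq \<Rightarrow> rbq" where
  "- x = RBQ (- rbq_re x) (- rbq_i x) (- rbq_j x) (- rbq_k x)"

definition minus_rbq :: "rbq \<Rightarrow> rbq \<Rightarrow> rbq" where
  "x - y = RBQ (rbq_re x - rbq_re y) (rbq_i x - rbq_i y) (rbq_j x - rbq_j y) (rbq_k x - rbq_k y)"

text \<open>
  The bilinear extension of \<open>i\<^sup>2 = k\<^sup>2 = -1\<close>, \<open>j\<^sup>2 = 1\<close>, \<open>ij = ji = k\<close>, \<open>jk = kj = i\<close>,
  \<open>ki = ik = -j\<close>; the table is recovered in lemma \<open>rbq_units\<close>.
\<close>

definition times_rbq :: "rbq \<Rightarrow> rbq \<Rightarrow> rbq" where
  "x * y = RBQ
     (rbq_re x * rbq_re y - rbq_i x * rbq_i y + rbq_j x * rbq_j y - rbq_k x * rbq_k y)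
     (rbq_re x * rbq_i y + rbq_i x * rbq_re y + rbq_j x * rbq_k y + rbq_k x * rbq_j y)
     (rbq_re x * rbq_j y + rbq_j x * rbq_re y - rbq_i x * rbq_k y - rbq_k x * rbq_i y)
     (rbq_re x * rbq_k y + rbq_k x * rbq_re y + rbq_i x * rbq_j y + rbq_j x * rbq_i y)"

instance
proof
  fix x y z :: rbq
  show "x * y * z = x * (y * z)" "(x + y) * z = x * z + y * z"
    by (simp_all add: times_rbq_def plus_rbq_def algebra_simps)
  show "x * y = y * x" "1 * x = x" "x + y + z = x + (y + z)" "x + y = y + x" "0 + x = x"
    "- x + x = 0" "x - y = x + - y" "(0::rbq) \<noteq> 1"
    by (simp_all add: rbq.expand zero_rbq_def one_rbq_def plus_rbq_def uminus_rbq_def minus_rbq_def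
        times_rbq_def algebra_simps)
qed

end

lemma rbq_units:
  defines "i \<equiv> RBQ 0 1 0 0" and "j \<equiv> RBQ 0 0 1 0" and "k \<equiv> RBQ 0 0 0 1"
  shows "i * i = - 1" "k * k = - 1" "j * j = 1"
    "i * j = k" "j * i = k" "j * k = i" "k * j = i" "k * i = - j" "i * k = - j"
  by (simp_all add: i_def j_def k_def times_rbq_def one_rbq_def uminus_rbq_def)

instantiation rbq :: real_normed_vector
begin

definition norm_rbq :: "rbq \<Rightarrow> real" where
  "norm x = sqrt ((rbq_re x)\<^sup>2 + (rbq_i x)\<^sup>2 + (rbq_j x)\<^sup>2 + (rbq_k x)\<^sup>2)"

definition scaleR_rbq :: "real \<Rightarrow> rbq \<Rightarrow> rbq" where
  "r *\<^sub>R x = RBQ (r * rbq_re x) (r * rbq_i x) (r * rbq_j x) (r * rbq_k x)"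

definition sgn_rbq :: "rbq \<Rightarrow> rbq" where
  "sgn (x::rbq) = scaleR (inverse (norm x)) x"

definition dist_rbq :: "rbq \<Rightarrow> rbq \<Rightarrow> real" where
  "dist (x::rbq) y = norm (x - y)"

definition uniformity_rbq :: "(rbq \<times> rbq) filter" where
  "uniformity = (INF e\<in>{0<..}. principal {(x::rbq, y). dist x y < e})"

definition open_rbq :: "rbq set \<Rightarrow> bool" where
  "open (U::rbq set) \<longleftrightarrow> (\<forall>x\<in>U. \<forall>\<^sub>F (x', y) in uniformity. x' = x \<longrightarrow> y \<in> U)"

instance
proof
  have norm_pair: "norm x = norm (Complex (rbq_re x) (rbq_i x), Complex (rbq_j x) (rbq_k x))" for x
    by (simp add: norm_rbq_def norm_Pair complex_norm add.assoc)
  fix r s :: real and x y :: rbq and U :: "rbq set"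
  show "r *\<^sub>R (x + y) = r *\<^sub>R x + r *\<^sub>R y" "(r + s) *\<^sub>R x = r *\<^sub>R x + s *\<^sub>R x"
    "r *\<^sub>R s *\<^sub>R x = (r * s) *\<^sub>R x" "1 *\<^sub>R x = x"
    by (simp_all add: scaleR_rbq_def plus_rbq_def algebra_simps)
  show "norm x = 0 \<longleftrightarrow> x = 0"
    by (cases x) (simp add: norm_pair zero_rbq_def zero_prod_def Complex_eq_0)
  have "Complex (rbq_re (x + y)) (rbq_i (x + y)) =
          Complex (rbq_re x) (rbq_i x) + Complex (rbq_re y) (rbq_i y)"
    "Complex (rbq_j (x + y)) (rbq_k (x + y)) =
          Complex (rbq_j x) (rbq_k x) + Complex (rbq_j y) (rbq_k y)"
    by (simp_all add: plus_rbq_def complex_eq_iff)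
  then show "norm (x + y) \<le> norm x + norm y"
    unfolding norm_pair by (metis add_Pair norm_triangle_ineq)
  have "(Complex (rbq_re (r *\<^sub>R x)) (rbq_i (r *\<^sub>R x)), Complex (rbq_j (r *\<^sub>R x)) (rbq_k (r *\<^sub>R x)))
          = r *\<^sub>R (Complex (rbq_re x) (rbq_i x), Complex (rbq_j x) (rbq_k x))"
    by (simp add: scaleR_rbq_def complex_eq_iff)
  then show "norm (r *\<^sub>R x) = \<bar>r\<bar> * norm x"
    unfolding norm_pair by (metis norm_scaleR)
qed (simp_all add: sgn_rbq_def dist_rbq_def uniformity_rbq_def open_rbq_def)

end

definition rbq_of_complex :: "complex \<Rightarrow> rbq" where
  "rbq_of_complex z = RBQ (Re z) (Im z) 0 0"

text \<open>The complex components \<open>r\<^sub>1, r\<^sub>2\<close> of \<open>r\<^sub>1 + r\<^sub>2 j\<close>.\<close>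

definition rbq_c1 :: "rbq \<Rightarrow> complex" where
  "rbq_c1 x = Complex (rbq_re x) (rbq_i x)"

definition rbq_c2 :: "rbq \<Rightarrow> complex" where
  "rbq_c2 x = Complex (rbq_j x) (rbq_k x)"

lemma rbq_c1_c2_decomp:
  "x = rbq_of_complex (rbq_c1 x) + rbq_of_complex (rbq_c2 x) * RBQ 0 0 1 0"
  by (cases x) (simp add: rbq_of_complex_def rbq_c1_def rbq_c2_def plus_rbq_def times_rbq_def)

section \<open>Matrices\<close>

text \<open>An \<open>m \<times> n\<close> matrix has type \<^typ>\<open>'a^'n^'m\<close>: the last index counts rows.\<close>

text \<open>Used for both complex and reduced biquaternion matrices.\<close>

definition frobenius_norm :: "('a::real_normed_vector)^'n^'m \<Rightarrow> real" where
  "frobenius_norm M = sqrt (\<Sum>s\<in>UNIV. \<Sum>t\<in>UNIV. (norm (M $ s $ t))\<^sup>2)"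

definition spectral_norm :: "complex^'n^'m \<Rightarrow> real" where
  "spectral_norm M = onorm (\<lambda>x. M *v x)"

definition conj_transpose :: "complex^'n^'m \<Rightarrow> complex^'m^'n" where
  "conj_transpose M = map_matrix cnj (transpose M)"

definition is_moore_penrose :: "complex^'n^'m \<Rightarrow> complex^'m^'n \<Rightarrow> bool" where
  "is_moore_penrose M G \<longleftrightarrow>
     M ** G ** M = M \<and> G ** M ** G = G \<and>
     conj_transpose (M ** G) = M ** G \<and> conj_transpose (G ** M) = G ** M"

definition moore_penrose :: "complex^'n^'m \<Rightarrow> complex^'m^'n" where
  "moore_penrose M = (THE G. is_moore_penrose M G)"

definition full_row_rank :: "complex^'n^'m \<Rightarrow> bool" where
  "full_row_rank M \<longleftrightarrow> rank M = CARD('m)"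

definition rbq_matrix_of_complex :: "complex^'n^'m \<Rightarrow> rbq^'n^'m" where
  "rbq_matrix_of_complex M = map_matrix rbq_of_complex M"

text \<open>
  \<open>M\<^sup>C\<^sub>c = [L\<^sub>1\<^sup>T, L\<^sub>2\<^sup>T]\<^sup>T\<close> for \<open>M = L\<^sub>1 + L\<^sub>2 j\<close>. The \<open>2m\<close> rows are indexed by \<^typ>\<open>'m + 'm\<close>, with
  \<^const>\<open>Inl\<close> for the rows of \<open>L\<^sub>1\<close> and \<^const>\<open>Inr\<close> for those of \<open>L\<^sub>2\<close>.
\<close>

definition block_column :: "rbq^'n^'m \<Rightarrow> complex^'n^('m + 'm)" where
  "block_column M =
     (\<chi> s t. case s of Inl s' \<Rightarrow> rbq_c1 (M $ s' $ t) | Inr s' \<Rightarrow> rbq_c2 (M $ s' $ t))"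

section \<open>The complex solution of the constrained least squares problem\<close>

definition RBLSE_minimizer ::
  "rbq^'n^'m \<Rightarrow> rbq^'d^'m \<Rightarrow> rbq^'n^'p \<Rightarrow> rbq^'d^'p \<Rightarrow> complex^'d^'n \<Rightarrow> bool" where
  "RBLSE_minimizer A B C D X \<longleftrightarrow>
     C ** rbq_matrix_of_complex X = D \<and>
     (\<forall>Y. C ** rbq_matrix_of_complex Y = D \<longrightarrow>
        frobenius_norm (A ** rbq_matrix_of_complex X - B)
          \<le> frobenius_norm (A ** rbq_matrix_of_complex Y - B))"

definition complex_solution ::
  "rbq^'n^'m \<Rightarrow> rbq^'d^'m \<Rightarrow> rbq^'n^'p \<Rightarrow> rbq^'d^'p \<Rightarrow> complex^'d^'n \<Rightarrow> bool" where
  "complex_solution A B C D X \<longleftrightarrow>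
     RBLSE_minimizer A B C D X \<and>
     (\<forall>Y. RBLSE_minimizer A B C D Y \<and> Y \<noteq> X \<longrightarrow> frobenius_norm X < frobenius_norm Y)"

section \<open>Quantities of the perturbation bound\<close>

definition perturbation_bound ::
  "rbq^'n^'m \<Rightarrow> rbq^'d^'m \<Rightarrow> rbq^'n^'p \<Rightarrow> rbq^'d^'p \<Rightarrow>
   rbq^'n^'m \<Rightarrow> rbq^'d^'m \<Rightarrow> rbq^'n^'p \<Rightarrow> rbq^'d^'p \<Rightarrow> real \<Rightarrow> bool" where
  "perturbation_bound A B C D \<Delta>A \<Delta>B \<Delta>C \<Delta>D e \<longleftrightarrow>
     frobenius_norm \<Delta>A \<le> e * frobenius_norm A \<and>
     frobenius_norm \<Delta>B \<le> e * frobenius_norm B \<and>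
     frobenius_norm \<Delta>C \<le> e * frobenius_norm C \<and>
     frobenius_norm \<Delta>D \<le> e * frobenius_norm D"

definition smallest_perturbation_bound ::
  "rbq^'n^'m \<Rightarrow> rbq^'d^'m \<Rightarrow> rbq^'n^'p \<Rightarrow> rbq^'d^'p \<Rightarrow>
   rbq^'n^'m \<Rightarrow> rbq^'d^'m \<Rightarrow> rbq^'n^'p \<Rightarrow> rbq^'d^'p \<Rightarrow> real \<Rightarrow> bool" where
  "smallest_perturbation_bound A B C D \<Delta>A \<Delta>B \<Delta>C \<Delta>D e \<longleftrightarrow>
     perturbation_bound A B C D \<Delta>A \<Delta>B \<Delta>C \<Delta>D e \<and>
     (\<forall>e'. perturbation_bound A B C D \<Delta>A \<Delta>B \<Delta>C \<Delta>D e' \<longrightarrow> e \<le> e')"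

definition P_c :: "rbq^'n^'p \<Rightarrow> complex^'n^'n" where
  "P_c C = mat 1 - moore_penrose (block_column C) ** block_column C"

definition L_c :: "rbq^'n^'m \<Rightarrow> rbq^'n^'p \<Rightarrow> complex^('p + 'p)^'n" where
  "L_c A C =
     (mat 1 - moore_penrose (block_column A ** P_c C) ** block_column A)
       ** moore_penrose (block_column C)"

definition K_A :: "rbq^'n^'m \<Rightarrow> rbq^'n^'p \<Rightarrow> real" where
  "K_A A C = frobenius_norm (block_column C) * spectral_norm (L_c A C)"

definition K_B :: "rbq^'n^'m \<Rightarrow> rbq^'n^'p \<Rightarrow> real" where
  "K_B A C =
     frobenius_norm (block_column A) * spectral_norm (moore_penrose (block_column A ** P_c C))"

definition R_c :: "rbq^'n^'m \<Rightarrow> rbq^'d^'m \<Rightarrow> complex^'d^'n \<Rightarrow> complex^'d^('m + 'm)" where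
  "R_c A B X = block_column B - block_column A ** X"

end

theory Submission
  imports Defs
begin

text \<open>
  Write \<open>A\<close>, \<open>B\<close>, \<open>C\<close>, \<open>D\<close> for the block columns, \<open>P = I - C\<^sup>\<dagger>C\<close>,
  \<open>G = (AP)\<^sup>\<dagger>\<close>, \<open>L = (I - GA)C\<^sup>\<dagger>\<close>, and \<open>N = I - LC - GA\<close>, the orthogonal projector onto
  \<open>ker A \<inter> ker C\<close>. Applying \<open>I = LC + GA + N\<close> to the error and inserting the optimality conditions
  \<open>CX = D\<close>, \<open>A\<^sup>H R = C\<^sup>H \<Lambda>\<close> and \<open>NX = 0\<close> of both problems gives the exact identity
  \<open>\<Delta>X = L(\<Delta>D - \<Delta>C X') + G(\<Delta>B - \<Delta>A X') + GG\<^sup>H(\<Delta>A\<^sup>H R' - \<Delta>C\<^sup>H \<Lambda>') + NX'\<close>,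
  where primed quantities belong to the perturbed problem.

  In the rank-deficient case \<open>NX'\<close> contributes to first order. If \<open>S = L\<Delta>C + G\<Delta>A\<close>, then every
  \<open>w\<close> in the perturbed common kernel satisfies \<open>w = Nw - Sw\<close>; as the ranks agree, \<open>Nw\<close> ranges over
  all of \<open>ker A \<inter> ker C\<close>, and since \<open>X'\<close> is orthogonal to every such \<open>w\<close>, it follows that
  \<open>NX' = NS\<^sup>H X\<close> up to second order. This term costs nothing extra: \<open>N\<Delta>C\<^sup>H L\<^sup>H X\<close> is orthogonal to
  \<open>L\<Delta>C X\<close>, and the two involve the complementary parts \<open>\<Delta>C N\<close> and \<open>\<Delta>C(I - N)\<close>, so together they
  are bounded by \<open>\<parallel>L\<parallel>\<^sub>2 \<parallel>\<Delta>C\<parallel>\<^sub>F \<parallel>X\<parallel>\<^sub>F\<close>; the same holds for \<open>\<Delta>A\<close> and \<open>G\<close>.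
\<close>

section \<open>Norms and conjugate transposes of complex matrices\<close>

notation conj_transpose (\<open>_\<^sup>H\<close> [1000] 1000)

lemma frobenius_norm_eq_norm: "frobenius_norm M = norm M"
  by (simp add: frobenius_norm_def norm_vec_def L2_set_def sum_nonneg)

lemma matrix_diff_ldistrib: "A ** (B - C) = A ** B - A ** C"
  for A :: "'a::comm_ring_1^'n^'m"
  by (simp add: vec_eq_iff matrix_matrix_mult_def right_diff_distrib sum_subtractf)

lemma matrix_diff_rdistrib: "(A - B) ** C = A ** C - B ** C"
  for A :: "'a::comm_ring_1^'n^'m"
  by (simp add: vec_eq_iff matrix_matrix_mult_def left_diff_distrib sum_subtractf)

lemma matrix_add_rdistrib: "(A + B) ** C = A ** C + B ** C"
  for A :: "'a::semiring_1^'n^'m"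
  by (simp add: vec_eq_iff matrix_matrix_mult_def distrib_right sum.distrib)

lemma matrix_minus_left: "(- A) ** B = - (A ** B)"
  for A :: "'a::comm_ring_1^'n^'m"
  by (simp add: vec_eq_iff matrix_matrix_mult_def sum_negf)

lemma matrix_minus_right: "A ** (- B) = - (A ** B)"
  for A :: "'a::comm_ring_1^'n^'m"
  by (simp add: vec_eq_iff matrix_matrix_mult_def sum_negf)

lemma matrix_scaleR_right: "A ** (r *\<^sub>R B) = r *\<^sub>R (A ** B)"
  for A :: "complex^'n^'m"
  by (simp add: vec_eq_iff matrix_matrix_mult_def scaleR_sum_right)

lemmas matrix_distribs = matrix_add_ldistrib matrix_add_rdistrib
  matrix_diff_ldistrib matrix_diff_rdistrib matrix_minus_left matrix_minus_right

lemma conj_transpose_nth [simp]: "M\<^sup>H $ i $ j = cnj (M $ j $ i)"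
  by (simp add: conj_transpose_def transpose_def)

lemma conj_transpose_conj_transpose [simp]: "M\<^sup>H\<^sup>H = M"
  by (simp add: vec_eq_iff)

lemma conj_transpose_mult: "(M ** N)\<^sup>H = N\<^sup>H ** M\<^sup>H"
  by (simp add: vec_eq_iff matrix_matrix_mult_def mult.commute)

lemma conj_transpose_add: "(M + N)\<^sup>H = M\<^sup>H + N\<^sup>H"
  and conj_transpose_diff: "(M - N)\<^sup>H = M\<^sup>H - N\<^sup>H"
  and conj_transpose_zero [simp]: "0\<^sup>H = 0"
  by (simp_all add: vec_eq_iff)

lemma conj_transpose_mat_1 [simp]: "(mat 1)\<^sup>H = mat 1"
  by (simp add: vec_eq_iff mat_def)

lemma inner_conj_transpose_vec: "(M *v x) \<bullet> y = x \<bullet> (M\<^sup>H *v y)"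
  for M :: "complex^'n^'m"
proof -
  have "(M *v x) \<bullet> y = (\<Sum>i\<in>UNIV. \<Sum>j\<in>UNIV. (M $ i $ j * x $ j) \<bullet> (y $ i))"
    by (simp add: inner_vec_def matrix_vector_mult_def inner_sum_left)
  also have "\<dots> = (\<Sum>j\<in>UNIV. \<Sum>i\<in>UNIV. (M $ i $ j * x $ j) \<bullet> (y $ i))"
    by (rule sum.swap)
  also have "\<dots> = x \<bullet> (M\<^sup>H *v y)"
  proof -
    have "(a * b) \<bullet> c = b \<bullet> (cnj a * c)" for a b c :: complex
      by (simp add: inner_complex_def algebra_simps)
    then show ?thesis
      by (simp add: inner_vec_def matrix_vector_mult_def inner_sum_right)
  qed
  finally show ?thesis .
qed

lemma column_matrix_mult: "column j (M ** N) = M *v column j N"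
  by (simp add: vec_eq_iff column_def matrix_matrix_mult_def matrix_vector_mult_def)

lemma inner_eq_sum_column: "M \<bullet> N = (\<Sum>j\<in>UNIV. column j M \<bullet> column j N)"
  unfolding inner_vec_def column_def by simp (rule sum.swap)

lemma inner_conj_transpose: "(M ** X) \<bullet> Y = X \<bullet> (M\<^sup>H ** Y)"
  for M :: "complex^'n^'m"
  by (simp add: inner_eq_sum_column column_matrix_mult inner_conj_transpose_vec)

lemma norm_conj_transpose [simp]: "norm (M\<^sup>H) = norm M"
proof -
  have "(norm (M\<^sup>H))\<^sup>2 = (norm M)\<^sup>2"
    unfolding power2_norm_eq_inner inner_vec_def
    by (simp add: inner_complex_def) (rule sum.swap)
  then show ?thesis by simp
qed

lemma norm_power2_eq_sum_column: "(norm M)\<^sup>2 = (\<Sum>j\<in>UNIV. (norm (column j M))\<^sup>2)"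
  for M :: "complex^'n^'m"
  by (simp add: power2_norm_eq_inner inner_eq_sum_column)

lemma spectral_norm_vec: "norm (M *v x) \<le> spectral_norm M * norm x"
  unfolding spectral_norm_def by (rule onorm) simp

lemma spectral_norm_nonneg [simp]: "0 \<le> spectral_norm M"
  unfolding spectral_norm_def by (rule onorm_pos_le) simp

lemma spectral_norm_0 [simp]: "spectral_norm 0 = 0"
  by (simp add: spectral_norm_def onorm_zero)

text \<open>Apply the vector bound to each column; squared Frobenius norms add up over the
  columns.\<close>

lemma norm_matrix_mult_spectral: "norm (M ** N) \<le> spectral_norm M * norm N"
proof (rule power2_le_imp_le)
  have "(norm (M ** N))\<^sup>2 \<le> (\<Sum>j\<in>UNIV. (spectral_norm M * norm (column j N))\<^sup>2)"
    unfolding norm_power2_eq_sum_column column_matrix_mult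
    by (intro sum_mono power_mono spectral_norm_vec norm_ge_zero)
  then show "(norm (M ** N))\<^sup>2 \<le> (spectral_norm M * norm N)\<^sup>2"
    by (simp add: power_mult_distrib norm_power2_eq_sum_column sum_distrib_left)
qed simp

text \<open>The square of \<open>norm (M\<^sup>H *v y)\<close> is
  \<open>(M *v (M\<^sup>H *v y)) \<bullet> y\<close>; after Cauchy-Schwarz one factor
  cancels.\<close>

lemma spectral_norm_conj_transpose_le: "spectral_norm (M\<^sup>H) \<le> spectral_norm M"
  unfolding spectral_norm_def[of "M\<^sup>H"]
proof (rule onorm_le)
  fix y
  have "(norm (M\<^sup>H *v y))\<^sup>2 = (M *v (M\<^sup>H *v y)) \<bullet> y"
    by (simp add: power2_norm_eq_inner inner_conj_transpose_vec)
  also have "\<dots> \<le> norm (M *v (M\<^sup>H *v y)) * norm y"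
    by (rule norm_cauchy_schwarz)
  also have "\<dots> \<le> spectral_norm M * norm (M\<^sup>H *v y) * norm y"
    by (intro mult_right_mono spectral_norm_vec norm_ge_zero)
  finally have "norm (M\<^sup>H *v y) * norm (M\<^sup>H *v y) \<le> norm (M\<^sup>H *v y) * (spectral_norm M * norm y)"
    by (simp add: power2_eq_square mult_ac)
  then show "norm (M\<^sup>H *v y) \<le> spectral_norm M * norm y"
    by (cases "norm (M\<^sup>H *v y) = 0") (simp_all add: mult_nonneg_nonneg)
qed

lemma spectral_norm_conj_transpose [simp]: "spectral_norm (M\<^sup>H) = spectral_norm M"
  using spectral_norm_conj_transpose_le[of M] spectral_norm_conj_transpose_le[of "M\<^sup>H"] by simp

lemma norm_row_mult: "cmod ((M *v x) $ i) \<le> norm (M $ i) * norm x"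
  for M :: "complex^'n^'m"
proof -
  have "cmod ((M *v x) $ i) \<le> (\<Sum>j\<in>UNIV. \<bar>cmod (M $ i $ j)\<bar> * \<bar>cmod (x $ j)\<bar>)"
    by (simp add: matrix_vector_mult_def norm_mult sum_norm_le)
  also have "\<dots> \<le> norm (M $ i) * norm x"
    unfolding norm_vec_def by (rule L2_set_mult_ineq)
  finally show ?thesis .
qed

lemma norm_matrix_vector_mult: "norm (M *v x) \<le> norm M * norm x"
  for M :: "complex^'n^'m"
proof -
  have "norm (M *v x) \<le> L2_set (\<lambda>i. norm (M $ i) * norm x) UNIV"
    unfolding norm_vec_def[of "M *v x"] by (intro L2_set_mono norm_row_mult norm_ge_zero)
  also have "\<dots> = norm M * norm x"
    by (simp add: L2_set_left_distrib norm_vec_def[of M])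
  finally show ?thesis .
qed

lemma norm_matrix_mult: "norm (M ** N) \<le> norm M * norm N"
  for M :: "complex^'n^'m"
proof -
  have "spectral_norm M \<le> norm M"
    unfolding spectral_norm_def by (rule onorm_le) (rule norm_matrix_vector_mult)
  then show ?thesis
    by (rule order_trans[OF norm_matrix_mult_spectral mult_right_mono[OF _ norm_ge_zero]])
qed

lemma mult_conj_transpose_eq_0: "M\<^sup>H ** M = 0 \<Longrightarrow> M = 0"
  using inner_conj_transpose[of M "mat 1" M] by simp

text \<open>The Gram matrix \<open>M\<^sup>H ** M\<close> has the same kernel as
  \<open>M\<close>.\<close>

lemma conj_transpose_mult_cancel:
  assumes "M\<^sup>H ** M ** X = M\<^sup>H ** M ** Y"
  shows "M ** X = M ** Y"
proof -
  have "(M ** (X - Y))\<^sup>H ** (M ** (X - Y)) = (X - Y)\<^sup>H ** (M\<^sup>H ** M ** X - M\<^sup>H ** M ** Y)"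
    by (simp add: conj_transpose_mult conj_transpose_diff matrix_mul_assoc matrix_distribs)
  also have "\<dots> = 0"
    unfolding assms by simp
  finally have "M ** (X - Y) = 0"
    by (rule mult_conj_transpose_eq_0)
  then show ?thesis by (simp add: matrix_distribs)
qed

section \<open>Moore--Penrose inverses and rank\<close>

lemma ex_inner_inverse: "\<exists>Y. M ** Y ** M = M" for M :: "'a::field^'n^'m"
proof -
  obtain g where g: "Vector_Spaces.linear (*s) (*s) g" "\<forall>v\<in>range ((*v) M). M *v g v = v"
    using vec.linear_exists_right_inverse_on[OF matrix_vector_mul_linear_gen[of M] vec.subspace_UNIV] by blast
  have "M ** matrix g ** M = M"
    unfolding matrix_eq using g by (simp add: matrix_works flip: matrix_vector_mul_assoc)
  then show ?thesis ..
qed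

text \<open>Take \<open>S = U ** M\<^sup>H\<close> with \<open>U\<close> an inner inverse of the
  Gram matrix. As \<open>U\<^sup>H\<close> is another one, \<open>E = M ** S\<close> satisfies
  \<open>E\<^sup>H ** M = M\<close>, so \<open>E = E\<^sup>H ** E\<close> is Hermitian.\<close>

lemma ex_hermitian_inner_inverse: "\<exists>S. M ** S ** M = M \<and> (M ** S)\<^sup>H = M ** S"
proof -
  obtain U where U: "M\<^sup>H ** M ** U ** (M\<^sup>H ** M) = M\<^sup>H ** M" using ex_inner_inverse by blast
  have inner: "M ** V ** M\<^sup>H ** M = M" if "M\<^sup>H ** M ** V ** (M\<^sup>H ** M) = M\<^sup>H ** M" for V
    using conj_transpose_mult_cancel[of M "V ** (M\<^sup>H ** M)" "mat 1"] that
    by (simp add: matrix_mul_assoc)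
  define E where "E = M ** U ** M\<^sup>H"
  have "(M\<^sup>H ** M ** U ** (M\<^sup>H ** M))\<^sup>H = (M\<^sup>H ** M)\<^sup>H"
    using U by simp
  then have "M\<^sup>H ** M ** U\<^sup>H ** (M\<^sup>H ** M) = M\<^sup>H ** M"
    by (simp add: conj_transpose_mult matrix_mul_assoc)
  from inner[OF this] have "E\<^sup>H ** M = M"
    by (simp add: E_def conj_transpose_mult matrix_mul_assoc)
  then have "E\<^sup>H ** E = E"
    by (subst (2 3) E_def) (simp add: matrix_mul_assoc)
  then have "E\<^sup>H = E"
    using conj_transpose_mult[of "E\<^sup>H" E] by simp
  moreover have "M ** (U ** M\<^sup>H) = E" "E ** M = M"
    using inner[OF U] by (simp_all add: E_def matrix_mul_assoc)
  ultimately show ?thesis by (intro exI[of _ "U ** M\<^sup>H"]) simp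
qed

text \<open>If \<open>S\<close> and \<open>T\<close> are inner inverses with \<open>M ** S\<close>
  and \<open>T ** M\<close> Hermitian, then \<open>T ** M ** S\<close> has all four properties;
  \<open>T\<close> comes from \<open>M\<^sup>H\<close>.\<close>

lemma ex_moore_penrose: "\<exists>G. is_moore_penrose M G"
proof -
  obtain S where S: "M ** S ** M = M" "(M ** S)\<^sup>H = M ** S"
    using ex_hermitian_inner_inverse by blast
  obtain S' where S': "M\<^sup>H ** S' ** M\<^sup>H = M\<^sup>H" "(M\<^sup>H ** S')\<^sup>H = M\<^sup>H ** S'"
    using ex_hermitian_inner_inverse by blast
  define T where "T = S'\<^sup>H"
  have T: "M ** T ** M = M" "(T ** M)\<^sup>H = T ** M"
    using arg_cong[OF S'(1), of conj_transpose] S'(2)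
    by (simp_all add: T_def conj_transpose_mult matrix_mul_assoc)
  have left: "M ** (T ** M ** S) = M ** S"
    using T(1) by (simp add: matrix_mul_assoc)
  have right: "T ** M ** S ** M = T ** M"
    using S(1) by (metis matrix_mul_assoc)
  have "T ** M ** S ** M ** (T ** M ** S) = T ** M ** S"
    unfolding right using T(1) by (metis matrix_mul_assoc)
  then have "is_moore_penrose M (T ** M ** S)"
    unfolding is_moore_penrose_def left right using S T by simp
  then show ?thesis ..
qed

text \<open>\<open>M ** G\<close> and \<open>M ** K\<close> are Hermitian projectors onto the same
  range, hence equal, and likewise \<open>G ** M\<close> and \<open>K ** M\<close>.\<close>

lemma moore_penrose_unique:
  assumes "is_moore_penrose M G" "is_moore_penrose M K"
  shows "G = K"
proof -
  have G: "M ** G ** M = M" "G ** M ** G = G" "(M ** G)\<^sup>H = M ** G" "(G ** M)\<^sup>H = G ** M"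
    and K: "M ** K ** M = M" "K ** M ** K = K" "(M ** K)\<^sup>H = M ** K" "(K ** M)\<^sup>H = K ** M"
    using assms by (simp_all add: is_moore_penrose_def)
  have "(M ** G)\<^sup>H = (M ** K ** (M ** G))\<^sup>H"
    by (simp add: matrix_mul_assoc K(1))
  then have left: "M ** G = M ** K"
    unfolding conj_transpose_mult[of "M ** K"] G(3) K(3) by (simp add: matrix_mul_assoc G(1))
  have "(G ** M)\<^sup>H = (G ** (M ** K ** M))\<^sup>H"
    by (simp add: K(1))
  also have "\<dots> = (G ** M ** (K ** M))\<^sup>H"
    by (simp add: matrix_mul_assoc)
  also have "\<dots> = K ** (M ** G ** M)"
    unfolding conj_transpose_mult[of "G ** M"] G(4) K(4) by (simp add: matrix_mul_assoc)
  finally have right: "G ** M = K ** M"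
    by (simp add: G(1,4))
  have "G = K ** M ** G"
    using G(2) right by simp
  also have "\<dots> = K ** (M ** G)"
    by (simp add: matrix_mul_assoc)
  finally show ?thesis
    using K(2) left by (simp add: matrix_mul_assoc)
qed

lemma moore_penrose: "is_moore_penrose M (moore_penrose M)"
  unfolding moore_penrose_def
  using ex_moore_penrose moore_penrose_unique by (metis (mono_tags, lifting) theI)

lemma moore_penrose_simps [simp]:
  shows moore_penrose_inner: "M ** moore_penrose M ** M = M"
    and moore_penrose_outer: "moore_penrose M ** M ** moore_penrose M = moore_penrose M"
    and moore_penrose_hermitian_left: "(M ** moore_penrose M)\<^sup>H = M ** moore_penrose M"
    and moore_penrose_hermitian_right: "(moore_penrose M ** M)\<^sup>H = moore_penrose M ** M"
  using moore_penrose[of M] by (simp_all add: is_moore_penrose_def)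

lemma moore_penrose_0 [simp]: "moore_penrose 0 = 0"
  using moore_penrose_outer[of 0] by simp

section \<open>Rank, nullity and right inverses\<close>

lemma dim_range_conj_transpose_le:
  "vec.dim (range ((*v) (M\<^sup>H))) \<le> vec.dim (range ((*v) (transpose M)))"
  for M :: "complex^'n^'m"
proof -
  let ?c = "\<lambda>x::complex^'n. \<chi> i. cnj (x $ i)"
  obtain B where B: "vec.independent B" "range ((*v) (transpose M)) \<subseteq> vec.span B"
    "card B = vec.dim (range ((*v) (transpose M)))"
    by (rule vec.basis_exists) blast
  \<comment> \<open>Entrywise conjugation is only conjugate-linear, so it is followed through spans
    by hand.\<close>
  have "?c x \<in> vec.span (?c ` B)" if "x \<in> vec.span B" for x
    using that
  proof (induction rule: vec.span_induct_alt)
    case base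
    have "?c 0 = 0" by (simp add: vec_eq_iff)
    then show ?case by (simp add: vec.span_zero)
  next
    case (step a x y)
    have "?c (a *s x + y) = cnj a *s ?c x + ?c y" by (simp add: vec_eq_iff)
    then show ?case
      using step by (metis (no_types, lifting) vec.span_add vec.span_scale vec.span_base imageI)
  qed
  then have "?c (transpose M *v y) \<in> vec.span (?c ` B)" for y
    using B(2) by blast
  moreover have "M\<^sup>H *v x = ?c (transpose M *v (\<chi> i. cnj (x $ i)))" for x
    by (simp add: vec_eq_iff matrix_vector_mult_def transpose_def)
  ultimately have "M\<^sup>H *v x \<in> vec.span (?c ` B)" for x
    by (simp only:)
  then have "range ((*v) (M\<^sup>H)) \<subseteq> vec.span (?c ` B)"
    by blast
  then have "vec.dim (range ((*v) (M\<^sup>H))) \<le> card (?c ` B)"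
    using vec.finiteI_independent[OF B(1)] by (intro vec.dim_le_card) simp_all
  also have "\<dots> \<le> card B"
    using vec.finiteI_independent[OF B(1)] by (rule card_image_le)
  finally show ?thesis using B(3) by simp
qed

lemma rank_eq_dim_range_transpose: "rank M = vec.dim (range ((*v) (transpose M)))"
  for M :: "'a::field^'n^'m"
proof -
  have "range ((*v) (transpose M)) = vec.span (rows M)"
  proof
    show "range ((*v) (transpose M)) \<subseteq> vec.span (rows M)"
      using matrix_vector_mult_in_columnspace_gen[of "transpose M"] by (auto simp: columns_transpose)
    have "row i M \<in> range ((*v) (transpose M))" for i
      by (rule range_eqI[of _ _ "axis i 1"])
        (simp add: vec_eq_iff row_def transpose_def matrix_vector_mult_def axis_def
          if_distrib[of "\<lambda>x. _ * x"] cong: if_cong)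
    then show "vec.span (rows M) \<subseteq> range ((*v) (transpose M))"
      by (intro vec.span_minimal vec.subspace_image) (auto simp: rows_def)
  qed
  then show ?thesis by (simp add: row_rank_def_gen)
qed

text \<open>The range of \<open>M\<^sup>H\<close> has dimension \<open>rank M\<close> and is
  complementary to the kernel, with \<open>G ** M\<close> splitting each vector. In
  \<open>kernel_lift\<close> this turns equal ranks into equal kernel dimensions.\<close>

lemma rank_nullity: "rank M + vec.dim {x. M *v x = 0} = CARD('n)"
  for M :: "complex^'n^'m"
proof -
  define G where "G = moore_penrose M"
  let ?R = "range ((*v) (M\<^sup>H))" and ?K = "{x. M *v x = 0}"
  have "vec.dim (range ((*v) (transpose M))) \<le> vec.dim ?R"
  proof -
    define N where "N = map_matrix cnj M"
    have "N\<^sup>H = transpose M" "transpose N = M\<^sup>H"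
      by (simp_all add: N_def vec_eq_iff transpose_def)
    then show ?thesis using dim_range_conj_transpose_le[of N] by simp
  qed
  then have rank: "rank M = vec.dim ?R"
    using dim_range_conj_transpose_le[of M] rank_eq_dim_range_transpose[of M] by simp
  have "?R \<inter> ?K = {0}"
  proof -
    have "M\<^sup>H *v y = 0" if "M *v (M\<^sup>H *v y) = 0" for y
      using inner_conj_transpose_vec[of "M\<^sup>H" y "M\<^sup>H *v y"] that by simp
    moreover have "0 \<in> ?R" by (rule range_eqI[of _ _ 0]) simp
    ultimately show ?thesis by auto
  qed
  moreover have "{x + y |x y. x \<in> ?R \<and> y \<in> ?K} = UNIV"
  proof -
    have "x \<in> {x + y |x y. x \<in> ?R \<and> y \<in> ?K}" for x
    proof -
      have "M\<^sup>H ** G\<^sup>H = G ** M"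
        using moore_penrose_hermitian_right[of M] by (simp add: G_def conj_transpose_mult)
      then have "(G ** M) *v x \<in> ?R"
        by (metis matrix_vector_mul_assoc rangeI)
      moreover have "x - (G ** M) *v x \<in> ?K"
        by (simp add: matrix_vector_mult_diff_distrib matrix_vector_mul_assoc matrix_mul_assoc G_def)
      ultimately show ?thesis
        by (intro CollectI exI[of _ "(G ** M) *v x"] exI[of _ "x - (G ** M) *v x"]) simp
    qed
    then show ?thesis by blast
  qed
  moreover have "vec.subspace ?R" "vec.subspace ?K"
    by (simp_all add: vec.subspace_image vec.subspace_kernel)
  ultimately show ?thesis
    using vec.dim_sums_Int[of ?R ?K] rank by (simp add: vec_dim_card card_cart_basis)
qed

text \<open>Since \<open>rows M\<close> is only a set, counting must show that the rows are distinct
  as well as independent. Any right inverse \<open>K\<close> then turns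
  \<open>M ** moore_penrose M ** M = M\<close> into the claim.\<close>

lemma full_row_rank_right_inverse:
  assumes "full_row_rank M"
  shows "M ** moore_penrose M = mat 1"
proof -
  have rows: "rows M = range (\<lambda>i. row i M)"
    by (auto simp: rows_def)
  then have fin: "finite (rows M)"
    by simp
  have "vec.dim (rows M) \<le> card (rows M)"
    using fin by (intro vec.dim_le_card vec.span_superset)
  moreover have "card (rows M) \<le> CARD('b)"
    unfolding rows by (rule card_image_le) simp
  ultimately have card: "card (rows M) = CARD('b)" "card (rows M) = vec.dim (rows M)"
    using assms by (simp_all add: full_row_rank_def row_rank_def_gen)
  have inj: "inj (\<lambda>i. row i M)"
    using card(1) by (intro eq_card_imp_inj_on) (simp_all add: rows)
  have indep: "vec.independent (rows M)"
    using vec.card_eq_dim[OF subset_refl card(2) fin] vec.span_superset by blast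
  have "\<forall>i. c i = 0" if c: "(\<Sum>i\<in>UNIV. c i *s row i M) = 0" for c
  proof
    fix i
    let ?u = "\<lambda>v. c (the_inv (\<lambda>i. row i M) v)"
    have "(\<Sum>v\<in>rows M. ?u v *s v) = 0"
      using c by (simp add: rows sum.reindex[OF inj] the_inv_f_f[OF inj])
    then have "?u (row i M) = 0"
      by (rule vec.independentD[OF indep fin subset_refl]) (simp add: rows)
    then show "c i = 0" by (simp add: the_inv_f_f[OF inj])
  qed
  then obtain K where K: "M ** K = mat 1"
    using matrix_right_invertible_independent_rows[of M] by blast
  have "M ** moore_penrose M = M ** moore_penrose M ** M ** K"
    using K by (simp flip: matrix_mul_assoc)
  then show ?thesis using K by simp
qed

section \<open>Constrained least squares\<close>

text \<open>
  The first-order conditions of feasibility, of minimality of the residual among feasible points,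
  and of minimality of the norm among minimizers, with respect to the real inner product.
\<close>

definition lse_solution ::
  "complex^'n^'q \<Rightarrow> complex^'d^'q \<Rightarrow> complex^'n^'r \<Rightarrow> complex^'d^'r \<Rightarrow> complex^'d^'n \<Rightarrow> bool" where
  "lse_solution A B C D X \<longleftrightarrow>
     C ** X = D \<and>
     (\<forall>Z :: complex^'d^'n. C ** Z = 0 \<longrightarrow> (A ** Z) \<bullet> (B - A ** X) = 0) \<and>
     (\<forall>Z :: complex^'d^'n. A ** Z = 0 \<longrightarrow> C ** Z = 0 \<longrightarrow> Z \<bullet> X = 0)"

lemma inner_eq_0_if_norm_le:
  fixes u v :: "'a::real_inner"
  assumes "\<And>t. norm u \<le> norm (u - t *\<^sub>R v)"
  shows "v \<bullet> u = 0"
proof (cases "v = 0")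
  case False
  \<comment> \<open>This \<open>t\<close> minimizes the quadratic
    \<open>norm (u - t *\<^sub>R v) ^ 2\<close>.\<close>
  define t where "t = (v \<bullet> u) / (v \<bullet> v)"
  have t: "t * (v \<bullet> v) = v \<bullet> u" "t * (v \<bullet> u) = (v \<bullet> u)\<^sup>2 / (v \<bullet> v)"
    using False by (simp_all add: t_def power2_eq_square)
  have "norm u ^ 2 \<le> norm (u - t *\<^sub>R v) ^ 2"
    using assms by (simp add: power_mono)
  also have "\<dots> = norm u ^ 2 - 2 * (t * (v \<bullet> u)) + t * (t * (v \<bullet> v))"
    by (simp add: power2_norm_eq_inner inner_diff inner_commute)
  also have "\<dots> = norm u ^ 2 - (v \<bullet> u)\<^sup>2 / (v \<bullet> v)"
    unfolding t by simp
  finally have "(v \<bullet> u)\<^sup>2 / (v \<bullet> v) \<le> 0" by simp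
  then show ?thesis
    using False by (simp add: divide_le_0_iff flip: inner_gt_zero_iff)
qed simp

section \<open>Reduction to complex block columns\<close>

lemma block_column_add: "block_column (M + N) = block_column M + block_column N"
  by (simp add: vec_eq_iff block_column_def rbq_c1_def rbq_c2_def plus_rbq_def complex_eq_iff
      split: sum.split)

lemma block_column_diff: "block_column (M - N) = block_column M - block_column N"
  by (simp add: vec_eq_iff block_column_def rbq_c1_def rbq_c2_def minus_rbq_def complex_eq_iff
      split: sum.split)

lemma block_column_eq_iff: "block_column M = block_column N \<longleftrightarrow> M = N"
proof -
  have "x = y" if "rbq_c1 x = rbq_c1 y" "rbq_c2 x = rbq_c2 y" for x y
    using that rbq_c1_c2_decomp by metis
  then show ?thesis
    by (fastforce simp: vec_eq_iff block_column_def split: sum.splits)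
qed

lemma rbq_components_sum:
  "rbq_c1 (sum f S) = (\<Sum>x\<in>S. rbq_c1 (f x))" "rbq_c2 (sum f S) = (\<Sum>x\<in>S. rbq_c2 (f x))"
proof -
  have "rbq_c1 (x + y) = rbq_c1 x + rbq_c1 y" "rbq_c2 (x + y) = rbq_c2 x + rbq_c2 y"
    "rbq_c1 0 = 0" "rbq_c2 0 = 0" for x y
    by (simp_all add: rbq_c1_def rbq_c2_def plus_rbq_def zero_rbq_def complex_eq_iff)
  then show "rbq_c1 (sum f S) = (\<Sum>x\<in>S. rbq_c1 (f x))" "rbq_c2 (sum f S) = (\<Sum>x\<in>S. rbq_c2 (f x))"
    by (induction S rule: infinite_finite_induct) simp_all
qed

text \<open>Right multiplication by a complex matrix acts on the two complex components separately;
  this makes the problem with complex unknowns a purely complex one.\<close>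

lemma block_column_mult: "block_column (M ** rbq_matrix_of_complex X) = block_column M ** X"
proof -
  have "rbq_c1 (a * rbq_of_complex z) = rbq_c1 a * z" "rbq_c2 (a * rbq_of_complex z) = rbq_c2 a * z" for a z
    by (simp_all add: rbq_c1_def rbq_c2_def rbq_of_complex_def times_rbq_def complex_eq_iff algebra_simps)
  then show ?thesis
    by (simp add: vec_eq_iff block_column_def matrix_matrix_mult_def rbq_matrix_of_complex_def
        rbq_components_sum split: sum.split)
qed

lemma norm_block_column: "norm (block_column M) = frobenius_norm M"
proof -
  have "(norm x)\<^sup>2 = (cmod (rbq_c1 x))\<^sup>2 + (cmod (rbq_c2 x))\<^sup>2" for x
    by (simp add: norm_rbq_def rbq_c1_def rbq_c2_def cmod_power2)
  moreover have "(\<Sum>s\<in>UNIV. f s) = (\<Sum>s\<in>UNIV. f (Inl s)) + (\<Sum>s\<in>UNIV. f (Inr s))"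
    for f :: "'b + 'b \<Rightarrow> real"
    by (simp add: sum.Plus o_def flip: UNIV_Plus_UNIV)
  ultimately show ?thesis
    by (simp add: frobenius_norm_eq_norm[symmetric] frobenius_norm_def block_column_def sum.distrib)
qed

text \<open>Moving along the kernel of the constraint keeps feasibility, and moving along the common
  kernel also keeps the residual. Minimality on each such line gives an orthogonality
  condition.\<close>

lemma lse_solution_block_column:
  fixes A :: "rbq^'n^'m" and X :: "complex^'d^'n"
  assumes "complex_solution A B C D X"
  shows "lse_solution (block_column A) (block_column B) (block_column C) (block_column D) X"
proof -
  let ?A = "block_column A" and ?B = "block_column B" and ?C = "block_column C"
  have constraint: "C ** rbq_matrix_of_complex Y = D \<longleftrightarrow> ?C ** Y = block_column D" for Y
    using block_column_eq_iff block_column_mult by metis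
  have residual: "frobenius_norm (A ** rbq_matrix_of_complex Y - B) = norm (?B - ?A ** Y)" for Y
    by (simp add: norm_block_column[symmetric] block_column_diff block_column_mult norm_minus_commute)
  have min_iff: "RBLSE_minimizer A B C D Y \<longleftrightarrow> ?C ** Y = block_column D \<and>
      (\<forall>Z. ?C ** Z = block_column D \<longrightarrow> norm (?B - ?A ** Y) \<le> norm (?B - ?A ** Z))" for Y
    by (simp add: RBLSE_minimizer_def constraint residual)
  from assms have min: "?C ** X = block_column D"
      "\<And>Z. ?C ** Z = block_column D \<Longrightarrow> norm (?B - ?A ** X) \<le> norm (?B - ?A ** Z)"
    and least: "\<And>Y. RBLSE_minimizer A B C D Y \<Longrightarrow> norm X \<le> norm Y"
    unfolding complex_solution_def min_iff frobenius_norm_eq_norm by (blast, blast, force simp: min_iff)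
  show ?thesis
    unfolding lse_solution_def
  proof (intro conjI allI impI min(1))
    fix Z :: "complex^'d^'n" assume "?C ** Z = 0"
    then have "norm (?B - ?A ** X) \<le> norm (?B - ?A ** X - t *\<^sub>R (?A ** Z))" for t
      using min(2)[of "X + t *\<^sub>R Z"] min(1)
      by (simp add: matrix_add_ldistrib matrix_scaleR_right algebra_simps)
    then show "(?A ** Z) \<bullet> (?B - ?A ** X) = 0"
      by (rule inner_eq_0_if_norm_le)
  next
    fix Z :: "complex^'d^'n" assume "?A ** Z = 0" "?C ** Z = 0"
    then have "RBLSE_minimizer A B C D (X - t *\<^sub>R Z)" for t
      unfolding min_iff using min by (simp add: matrix_diff_ldistrib matrix_scaleR_right)
    then have "norm X \<le> norm (X - t *\<^sub>R Z)" for t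
      using least by blast
    then show "Z \<bullet> X = 0"
      by (rule inner_eq_0_if_norm_le)
  qed
qed

text \<open>Testing the real orthogonality condition with \<open>W ** (W\<^sup>H ** X)\<close>
  upgrades it to a matrix equation.\<close>

lemma lse_solution_kernel:
  assumes "lse_solution A B C D X" "A ** W = 0" "C ** W = 0"
  shows "W\<^sup>H ** X = 0"
proof -
  have "A ** (W ** (W\<^sup>H ** X)) = 0" "C ** (W ** (W\<^sup>H ** X)) = 0"
    using assms(2,3) by (simp_all add: matrix_mul_assoc)
  then have "(W ** (W\<^sup>H ** X)) \<bullet> X = 0"
    using assms(1) unfolding lse_solution_def by blast
  then have "(W\<^sup>H ** X) \<bullet> (W\<^sup>H ** X) = 0"
    by (simp only: inner_conj_transpose)
  then show ?thesis by simp
qed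

text \<open>The Lagrange multiplier of the constraint is \<open>(C\<^sup>\<dagger>)\<^sup>H A\<^sup>H R\<close>, where \<open>R\<close> is the residual.\<close>

lemma lse_solution_multiplier:
  fixes A :: "complex^'n^'q" and C :: "complex^'n^'r"
  assumes "lse_solution A B C D X"
  defines "Y \<equiv> A\<^sup>H ** (B - A ** X)"
  shows "C\<^sup>H ** ((moore_penrose C)\<^sup>H ** Y) = Y"
proof -
  define E where "E = moore_penrose C ** C"
  have E: "E\<^sup>H = E" "C ** E = C" "E ** E = E"
    by (simp_all add: E_def matrix_mul_assoc)
  \<comment> \<open>\<open>Y - E ** Y\<close> is an admissible direction. It proves orthogonal to
    both \<open>Y\<close> and \<open>E ** Y\<close>, hence to itself.\<close>
  have "C ** (Y - E ** Y) = 0"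
    using E by (simp add: matrix_diff_ldistrib matrix_mul_assoc)
  then have "(A ** (Y - E ** Y)) \<bullet> (B - A ** X) = 0"
    using assms(1) unfolding lse_solution_def by blast
  then have "(Y - E ** Y) \<bullet> Y = 0"
    by (simp add: inner_conj_transpose Y_def)
  moreover have "(Y - E ** Y) \<bullet> (E ** Y) = 0"
  proof -
    have "(E ** (Y - E ** Y)) \<bullet> Y = (Y - E ** Y) \<bullet> (E ** Y)"
      by (simp add: inner_conj_transpose E(1))
    moreover have "E ** (Y - E ** Y) = 0"
      by (simp add: matrix_diff_ldistrib matrix_mul_assoc E(3))
    ultimately show ?thesis by simp
  qed
  ultimately have "(Y - E ** Y) \<bullet> (Y - E ** Y) = 0"
    by (simp add: inner_diff_right)
  then have "E\<^sup>H ** Y = Y" using E(1) by simp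
  then show ?thesis by (simp add: E_def conj_transpose_mult matrix_mul_assoc)
qed

section \<open>Projectors and solution operators of the unperturbed problem\<close>

locale lse_data =
  fixes A :: "complex^'n^'q" and C :: "complex^'n^'r"
begin

abbreviation Cp :: "complex^'r^'n" where "Cp \<equiv> moore_penrose C"

definition P :: "complex^'n^'n" where "P = mat 1 - Cp ** C"

definition G :: "complex^'q^'n" where "G = moore_penrose (A ** P)"

text \<open>A solution satisfies \<open>N ** X = 0\<close> and \<open>G ** (B - A ** X) = 0\<close>,
  so \<open>split\<close> reads \<open>X = L ** D + G ** B\<close>: \<open>L\<close> and
  \<open>G\<close> are the solution operators.\<close>

definition L :: "complex^'r^'n" where "L = (mat 1 - G ** A) ** Cp"

definition N :: "complex^'n^'n" where "N = mat 1 - L ** C - G ** A"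

lemma P_hermitian: "P\<^sup>H = P"
  by (simp add: P_def conj_transpose_diff)

lemma P_idem: "P ** P = P" and C_P: "C ** P = 0" and P_Cp: "P ** Cp = 0"
  by (simp_all add: P_def matrix_distribs matrix_mul_assoc)

text \<open>The Hermitian product \<open>G ** (A ** P)\<close> equals its conjugate transpose, which
  begins with \<open>P\<close>, and it fixes \<open>G\<close> from the left.\<close>

lemma P_G: "P ** G = G"
proof -
  let ?H = "G ** (A ** P)"
  have H: "?H\<^sup>H = ?H" "?H ** G = G"
    by (simp_all add: G_def)
  have "?H\<^sup>H = P ** (A\<^sup>H ** G\<^sup>H)"
    by (simp add: conj_transpose_mult P_hermitian matrix_mul_assoc)
  then have "P ** ?H = ?H"
    unfolding H(1) by (metis P_idem matrix_mul_assoc)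
  then show ?thesis
    using H(2) by (metis matrix_mul_assoc)
qed

lemma C_G: "C ** G = 0"
  by (metis C_P P_G matrix_mul_assoc times0_left)

lemma A_P_G: "A ** P ** G = A ** G"
  by (metis P_G matrix_mul_assoc)

lemma A_G_A_P: "A ** G ** A ** P = A ** P"
  using moore_penrose_inner[of "A ** P"] by (simp add: A_P_G matrix_mul_assoc flip: G_def)

lemma G_A_G: "G ** A ** G = G"
  using moore_penrose_outer[of "A ** P"] A_P_G by (simp flip: G_def matrix_mul_assoc)

text \<open>Comes from \<open>G = G ** (A ** P ** G)\<close> with a Hermitian bracket. In this form
  \<open>G\<close> sees a residual \<open>R\<close> only through \<open>A\<^sup>H ** R\<close>,
  where the optimality condition applies.\<close>

lemma G_eq: "G ** G\<^sup>H ** P ** A\<^sup>H = G"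
proof -
  have "(A ** P ** G)\<^sup>H = A ** P ** G"
    by (simp add: G_def)
  then have "G\<^sup>H ** P ** A\<^sup>H = A ** G"
    unfolding A_P_G[symmetric] by (simp add: conj_transpose_mult P_hermitian matrix_mul_assoc)
  then show ?thesis
    using G_A_G by (simp flip: matrix_mul_assoc)
qed

text \<open>\<open>L ** C\<close> is \<open>(mat 1 - G ** A) ** (mat 1 - P)\<close>. The new form is
  a difference of Hermitian projectors.\<close>

lemma N_eq: "N = P - G ** A ** P"
  by (simp add: N_def L_def P_def matrix_distribs matrix_mul_assoc)

lemma N_hermitian: "N\<^sup>H = N"
proof -
  have "(G ** (A ** P))\<^sup>H = G ** (A ** P)"
    by (simp add: G_def)
  then show ?thesis
    by (simp add: N_eq conj_transpose_diff P_hermitian matrix_mul_assoc)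
qed

lemma A_N: "A ** N = 0" and C_N: "C ** N = 0"
  by (simp_all add: N_eq matrix_distribs matrix_mul_assoc A_G_A_P C_P C_G)

lemma N_G: "N ** G = 0"
  by (simp add: N_eq matrix_distribs P_G) (metis A_P_G G_A_G P_G matrix_mul_assoc)

lemma N_Cp: "N ** Cp = 0"
  by (simp add: N_eq matrix_distribs P_Cp flip: matrix_mul_assoc)

lemma N_L: "N ** L = 0"
  by (simp add: L_def matrix_distribs matrix_mul_assoc N_G N_Cp)

lemma N_idem: "N ** N = N"
  using A_N C_N by (subst (1) N_def) (simp add: matrix_distribs flip: matrix_mul_assoc)

lemma G_conj_P: "G\<^sup>H ** P = G\<^sup>H"
  using arg_cong[OF P_G, of conj_transpose] by (simp add: conj_transpose_mult P_hermitian)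

lemma split: "Y = L ** (C ** Y) + G ** (A ** Y) + N ** Y"
  by (simp add: N_def matrix_distribs matrix_mul_assoc)

text \<open>\<open>P ** C\<^sup>H = 0\<close> removes the multiplier. The defect \<open>F\<close> is
  zero for the unperturbed problem and collects the perturbation terms for the perturbed
  one.\<close>

lemma G_residual:
  assumes "A\<^sup>H ** R = C\<^sup>H ** \<Lambda> + F"
  shows "G ** R = G ** G\<^sup>H ** F"
proof -
  have "G ** R = G ** G\<^sup>H ** P ** (C\<^sup>H ** \<Lambda> + F)"
    by (subst G_eq[symmetric]) (simp flip: assms matrix_mul_assoc)
  moreover have "P ** C\<^sup>H = 0"
    using arg_cong[OF C_P, of conj_transpose] by (simp add: conj_transpose_mult P_hermitian)
  moreover have "G ** G\<^sup>H ** P ** (C\<^sup>H ** \<Lambda> + F) = G ** (G\<^sup>H ** (P ** C\<^sup>H ** \<Lambda>)) + G ** (G\<^sup>H ** P) ** F"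
    by (simp add: matrix_add_ldistrib matrix_mul_assoc)
  ultimately show ?thesis
    by (simp add: G_conj_P)
qed

text \<open>\<open>A ** G\<close> is Hermitian and \<open>G ** R = 0\<close>, so the
  \<open>G\<close> part of \<open>L\<close> drops out. The multiplier becomes
  \<open>(A ** L)\<^sup>H ** R\<close>, whence the spectral norm of \<open>A ** L\<close> in the
  bound.\<close>

lemma L_conj: "L\<^sup>H ** A\<^sup>H ** R = Cp\<^sup>H ** A\<^sup>H ** R"
  if "A\<^sup>H ** R = C\<^sup>H ** \<Lambda>"
proof -
  have "G ** R = 0"
    using G_residual[of R \<Lambda> 0] that by simp
  have "(A ** G)\<^sup>H = A ** G"
    unfolding A_P_G[symmetric] by (simp add: G_def)
  then have "G\<^sup>H ** A\<^sup>H ** R = A ** (G ** R)"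
    by (simp add: conj_transpose_mult matrix_mul_assoc)
  then have "G\<^sup>H ** (A\<^sup>H ** R) = 0"
    using \<open>G ** R = 0\<close> by (simp add: matrix_mul_assoc)
  then show ?thesis
    by (simp add: L_def conj_transpose_mult conj_transpose_diff matrix_distribs flip: matrix_mul_assoc)
qed

section \<open>The exact error identity and its common-kernel term\<close>

lemma error_identity:
  assumes X: "lse_solution A B C D X"
    and X': "lse_solution (A + \<Delta>A) (B + \<Delta>B) (C + \<Delta>C) (D + \<Delta>D) X'"
    and R': "R' = B + \<Delta>B - (A + \<Delta>A) ** X'"
    and \<Lambda>': "(A + \<Delta>A)\<^sup>H ** R' = (C + \<Delta>C)\<^sup>H ** \<Lambda>'"
  shows "X' - X = L ** (\<Delta>D - \<Delta>C ** X') + G ** (\<Delta>B - \<Delta>A ** X')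
    + G ** G\<^sup>H ** (\<Delta>A\<^sup>H ** R' - \<Delta>C\<^sup>H ** \<Lambda>') + N ** X'"
proof -
  define R where "R = B - A ** X"
  have "G ** R = 0"
    using lse_solution_multiplier[OF X] G_residual[of R "Cp\<^sup>H ** (A\<^sup>H ** R)" 0]
    by (simp add: R_def)
  \<comment> \<open>The perturbed optimality condition, read as the unperturbed one with a
    defect.\<close>
  have "A\<^sup>H ** R' = C\<^sup>H ** \<Lambda>' + (\<Delta>C\<^sup>H ** \<Lambda>' - \<Delta>A\<^sup>H ** R')"
    using \<Lambda>' by (simp add: conj_transpose_add matrix_distribs algebra_simps)
  from G_residual[OF this] have GR': "G ** R' = - (G ** G\<^sup>H ** (\<Delta>A\<^sup>H ** R' - \<Delta>C\<^sup>H ** \<Lambda>'))"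
    by (simp add: matrix_distribs)
  have "A ** (X' - X) = (\<Delta>B - \<Delta>A ** X') + R - R'"
    by (simp add: R_def R' matrix_distribs)
  then have "G ** (A ** (X' - X)) = G ** (\<Delta>B - \<Delta>A ** X') + G ** R - G ** R'"
    by (simp add: matrix_distribs)
  also have "\<dots> = G ** (\<Delta>B - \<Delta>A ** X') + G ** G\<^sup>H ** (\<Delta>A\<^sup>H ** R' - \<Delta>C\<^sup>H ** \<Lambda>')"
    unfolding GR' \<open>G ** R = 0\<close> by simp
  finally have GA: "G ** (A ** (X' - X)) = \<dots>" .
  have "C ** X = D" "(C + \<Delta>C) ** X' = D + \<Delta>D"
    using X X' by (simp_all add: lse_solution_def)
  then have C: "C ** (X' - X) = \<Delta>D - \<Delta>C ** X'"
    by (simp add: matrix_distribs algebra_simps)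
  have "N ** X = 0"
    using lse_solution_kernel[OF X A_N C_N] by (simp add: N_hermitian)
  then have "N ** (X' - X) = N ** X'"
    by (simp add: matrix_distribs)
  then show ?thesis
    using split[of "X' - X"] unfolding GA C by (simp add: add.assoc)
qed

text \<open>
  Equality of the ranks makes the injective map \<open>T\<close> between the kernels of \<open>A'P'\<close> and \<open>AP\<close>
  bijective. Its \<open>C\<^sup>\<dagger>C'\<close> summand spares any estimate of \<open>P' - P\<close>.
\<close>

lemma kernel_lift:
  fixes A' :: "complex^'n^'q" and C' :: "complex^'n^'r"
  assumes C: "C ** Cp = mat 1" and C': "C' ** moore_penrose C' = mat 1"
    and rank: "rank (A' ** lse_data.P C') = rank (A ** P)"
    and small: "norm (L ** (C' - C) + G ** (A' - A)) < 1"
    and v: "A *v v = 0" "C *v v = 0"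
  obtains w where "A' *v w = 0" "C' *v w = 0" "N *v w = v"
proof -
  define P' where "P' = lse_data.P C'"
  define T where "T = N + Cp ** C'"
  let ?K' = "{x. (A' ** P') *v x = 0}" and ?K = "{x. (A ** P) *v x = 0}"
  have sub: "vec.subspace ?K'" "vec.subspace ?K"
    by (simp_all add: vec.subspace_kernel)
  \<comment> \<open>Whatever \<open>T\<close> sends into the kernel of \<open>C\<close> lies in the
    kernel of \<open>C'\<close>; this serves both injectivity and the final preimage.\<close>
  have CT: "C ** T = C'"
    by (simp add: T_def matrix_distribs C_N matrix_mul_assoc C)
  have APT: "A ** P ** T = 0"
  proof -
    have "P ** N = N"
      by (simp add: N_eq matrix_distribs matrix_mul_assoc P_idem P_G)
    then have "A ** P ** T = A ** N + A ** (P ** Cp) ** C'"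
      by (simp add: T_def matrix_distribs flip: matrix_mul_assoc)
    then show ?thesis by (simp add: A_N P_Cp)
  qed
  have ker: "A' *v x = 0 \<and> C' *v x = 0" if "x \<in> ?K'" "C' *v x = 0" for x
  proof -
    have "P' *v x = x"
      using that(2) unfolding P'_def lse_data.P_def
      by (simp add: matrix_vector_mult_diff_rdistrib flip: matrix_vector_mul_assoc)
    then show ?thesis using that by (simp flip: matrix_vector_mul_assoc)
  qed
  have N_ker: "N *v x = T *v x" if "C' *v x = 0" for x
    using that by (simp add: T_def matrix_vector_mult_add_rdistrib flip: matrix_vector_mul_assoc)
  have inj: "inj_on ((*v) T) ?K'"
  proof (rule inj_onI)
    fix x y assume xy: "x \<in> ?K'" "y \<in> ?K'" "T *v x = T *v y"
    define z where "z = x - y"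
    have "z \<in> ?K'" and Tz: "T *v z = 0"
      using xy by (simp_all add: z_def matrix_vector_mult_diff_distrib)
    have "C' *v z = 0"
      by (simp add: CT[symmetric] Tz flip: matrix_vector_mul_assoc)
    then have z: "A' *v z = 0" "C' *v z = 0" "N *v z = 0"
      using ker[OF \<open>z \<in> ?K'\<close>] N_ker[of z] Tz by simp_all
    then have "(L ** C' + G ** A') *v z = 0"
      by (simp add: matrix_vector_mult_add_rdistrib flip: matrix_vector_mul_assoc)
    moreover have "L ** (C' - C) + G ** (A' - A) = (L ** C' + G ** A') + (N - mat 1)"
      by (simp add: N_def matrix_distribs)
    \<comment> \<open>By \<open>split\<close>, \<open>z\<close> is minus its own image under a
      matrix of norm less than 1, which forces \<open>z = 0\<close>.\<close>
    ultimately have "z = - ((L ** (C' - C) + G ** (A' - A)) *v z)"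
      using z(3) by (simp add: matrix_vector_mult_diff_rdistrib matrix_vector_mult_add_rdistrib)
    then have le: "norm z \<le> norm (L ** (C' - C) + G ** (A' - A)) * norm z"
      by (metis norm_matrix_vector_mult norm_minus_cancel)
    have "\<not> 0 < norm z"
    proof
      assume "0 < norm z"
      from mult_strict_right_mono[OF small this] le show False by linarith
    qed
    then show "x = y" by (simp add: z_def)
  qed
  have "(*v) T ` ?K' = ?K"
  proof (rule vec.subspace_dim_equal)
    show "vec.subspace ((*v) T ` ?K')"
      by (rule vec.subspace_image[OF sub(1)])
    show "(*v) T ` ?K' \<subseteq> ?K"
      using APT by (auto simp: matrix_vector_mul_assoc)
    have "vec.dim ((*v) T ` ?K') = vec.dim ?K'"
      using inj sub(1) by (intro vec.dim_image_eq matrix_vector_mul_linear_gen) (simp add: vec.span_eq_iff[THEN iffD2])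
    also have "\<dots> = vec.dim ?K"
      using rank_nullity[of "A' ** P'"] rank_nullity[of "A ** P"] rank by (simp add: P'_def)
    finally show "vec.dim ?K \<le> vec.dim ((*v) T ` ?K')"
      by simp
  qed (rule sub(2))
  moreover have "v \<in> ?K"
    using v by (simp add: P_def matrix_vector_mult_diff_rdistrib flip: matrix_vector_mul_assoc)
  ultimately have "v \<in> (*v) T ` ?K'"
    by (simp only:)
  then obtain w where w: "w \<in> ?K'" "T *v w = v"
    by (elim imageE) simp
  have "C' *v w = 0"
    using v(2) by (simp add: CT[symmetric] w(2) flip: matrix_vector_mul_assoc)
  then show thesis
    by (intro that[of w]) (use ker[OF w(1)] N_ker[of w] w(2) in simp_all)
qed

text \<open>The columns of \<open>N\<close> lie in the common kernel; lifting them one by one gives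
  \<open>N ** W = N\<close>, and \<open>split\<close> yields the equation for
  \<open>W\<close>.\<close>

lemma kernel_matrix_lift:
  fixes A' :: "complex^'n^'q" and C' :: "complex^'n^'r"
  assumes "C ** Cp = mat 1" "C' ** moore_penrose C' = mat 1"
    "rank (A' ** lse_data.P C') = rank (A ** P)"
    "norm (L ** (C' - C) + G ** (A' - A)) < 1"
  obtains W where "A' ** W = 0" "C' ** W = 0" "W = N - (L ** (C' - C) + G ** (A' - A)) ** W"
proof -
  have "A *v column j N = 0" "C *v column j N = 0" for j
    by (simp_all add: A_N C_N flip: column_matrix_mult) (simp_all add: column_def vec_eq_iff)
  then have "\<exists>w. A' *v w = 0 \<and> C' *v w = 0 \<and> N *v w = column j N" for j
    using kernel_lift[OF assms, of "column j N"] by metis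
  then obtain w where w: "\<And>j. A' *v w j = 0" "\<And>j. C' *v w j = 0" "\<And>j. N *v w j = column j N"
    by metis
  define W :: "complex^'n^'n" where "W = (\<chi> i j. w j $ i)"
  have col: "column j W = w j" for j
    by (simp add: W_def column_def vec_eq_iff)
  have ext: "M = M'" if "\<And>j. column j M = column j M'" for M M' :: "complex^'n^'x"
    using that by (simp add: column_def vec_eq_iff)
  have W: "A' ** W = 0" "C' ** W = 0" "N ** W = N"
    using w by (intro ext; simp add: column_matrix_mult col; simp add: column_def vec_eq_iff)+
  have "W = N - (L ** (C' - C) + G ** (A' - A)) ** W"
    using split[of W] W by (simp add: matrix_distribs algebra_simps flip: matrix_mul_assoc)
  then show thesis using that W by blast
qed

text \<open>Since \<open>W\<^sup>H ** X' = 0\<close>, the equation for \<open>W\<close> turns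
  \<open>N ** X'\<close> into \<open>W\<^sup>H ** (S\<^sup>H ** X')\<close>. Substituting it once
  more separates the term linear in \<open>S\<close> from a quadratic one.\<close>

lemma kernel_component_identity:
  assumes X': "lse_solution A' B' C' D' X'"
    and W: "A' ** W = 0" "C' ** W = 0" "W = N - S ** W"
  shows "N ** X' = N ** (S\<^sup>H ** X') - W\<^sup>H ** (S\<^sup>H ** (S\<^sup>H ** X'))"
proof -
  have WX: "W\<^sup>H ** X' = 0"
    using lse_solution_kernel[OF X' W(1,2)] .
  have WH: "W\<^sup>H = N - W\<^sup>H ** S\<^sup>H"
    using arg_cong[OF W(3), of conj_transpose]
    by (simp add: conj_transpose_diff conj_transpose_mult N_hermitian)
  have "N ** X' = W\<^sup>H ** (S\<^sup>H ** X')"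
    using WX arg_cong[OF WH, of "\<lambda>M. M ** X'"] by (simp add: matrix_diff_rdistrib flip: matrix_mul_assoc)
  also have "\<dots> = (N - W\<^sup>H ** S\<^sup>H) ** (S\<^sup>H ** X')"
    using WH by simp
  finally show ?thesis
    by (simp add: matrix_diff_rdistrib flip: matrix_mul_assoc)
qed

section \<open>Orthogonality of the kernel terms to the direct terms\<close>

lemma norm_split: "(norm (M ** (mat 1 - N)))\<^sup>2 + (norm (M ** N))\<^sup>2 = (norm M)\<^sup>2"
proof -
  \<comment> \<open>Conjugate transposition moves \<open>N\<close> to the left, where it is
    self-adjoint for the inner product.\<close>
  have "M\<^sup>H = (mat 1 - N) ** M\<^sup>H + N ** M\<^sup>H"
    by (simp add: matrix_distribs)
  moreover have "((mat 1 - N) ** M\<^sup>H) \<bullet> (N ** M\<^sup>H) = 0"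
  proof -
    have "((mat 1 - N) ** M\<^sup>H) \<bullet> (N ** M\<^sup>H) = (N ** ((mat 1 - N) ** M\<^sup>H)) \<bullet> M\<^sup>H"
      by (simp add: inner_conj_transpose[of N] N_hermitian)
    also have "N ** ((mat 1 - N) ** M\<^sup>H) = 0"
      by (simp add: matrix_distribs matrix_mul_assoc N_idem)
    finally show ?thesis by simp
  qed
  ultimately have "(norm (M\<^sup>H))\<^sup>2 = (norm ((mat 1 - N) ** M\<^sup>H))\<^sup>2 + (norm (N ** M\<^sup>H))\<^sup>2"
    using norm_add_Pythagorean unfolding orthogonal_def by metis
  moreover have "(mat 1 - N) ** M\<^sup>H = (M ** (mat 1 - N))\<^sup>H" "N ** M\<^sup>H = (M ** N)\<^sup>H"
    by (simp_all add: conj_transpose_mult conj_transpose_diff N_hermitian)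
  ultimately show ?thesis by simp
qed

text \<open>
  The two terms are orthogonal and depend on the complementary parts \<open>E ** N\<close> and
  \<open>E ** (mat 1 - N)\<close> of \<open>E\<close>. The triangle inequality would lose a factor 2 here whenever \<open>A\<close> and
  \<open>C\<close> have a common kernel.
\<close>

lemma norm_paired_terms:
  assumes NJ: "N ** J = 0" and NX: "N ** X = 0"
  shows "norm (N ** (E\<^sup>H ** (J\<^sup>H ** X)) - J ** (E ** X)) \<le> spectral_norm J * norm E * norm X"
proof (rule power2_le_imp_le)
  let ?U = "N ** (E\<^sup>H ** (J\<^sup>H ** X))" and ?V = "J ** (E ** X)" and ?s = "spectral_norm J"
  have "?U \<bullet> ?V = (E\<^sup>H ** (J\<^sup>H ** X)) \<bullet> (N ** ?V)"
    by (simp add: inner_conj_transpose[of N] N_hermitian)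
  also have "N ** ?V = 0"
    by (simp add: matrix_mul_assoc NJ)
  finally have "?U \<bullet> ?V = 0" by simp
  then have "(norm (?U - ?V))\<^sup>2 = (norm ?U)\<^sup>2 + (norm ?V)\<^sup>2"
    by (simp add: power2_norm_eq_inner inner_diff inner_commute)
  moreover have "norm ?U \<le> norm (E ** N) * (?s * norm X)"
  proof -
    have "?U = (E ** N)\<^sup>H ** (J\<^sup>H ** X)"
      by (simp add: conj_transpose_mult N_hermitian matrix_mul_assoc)
    then have "norm ?U \<le> norm (E ** N) * norm (J\<^sup>H ** X)"
      using norm_matrix_mult[of "(E ** N)\<^sup>H"] by simp
    also have "\<dots> \<le> norm (E ** N) * (?s * norm X)"
      using norm_matrix_mult_spectral[of "J\<^sup>H" X] by (intro mult_left_mono) simp_all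
    finally show ?thesis .
  qed
  moreover have "norm ?V \<le> norm (E ** (mat 1 - N)) * (?s * norm X)"
  proof -
    have "E ** X = E ** (mat 1 - N) ** X"
      using NX by (simp add: matrix_distribs flip: matrix_mul_assoc)
    then have "norm (E ** X) \<le> norm (E ** (mat 1 - N)) * norm X"
      using norm_matrix_mult[of "E ** (mat 1 - N)" X] by simp
    then have "?s * norm (E ** X) \<le> ?s * (norm (E ** (mat 1 - N)) * norm X)"
      by (intro mult_left_mono) simp_all
    then show ?thesis
      using norm_matrix_mult_spectral[of J "E ** X"] by (simp add: mult_ac)
  qed
  ultimately have "(norm (?U - ?V))\<^sup>2
      \<le> (norm (E ** N) * (?s * norm X))\<^sup>2 + (norm (E ** (mat 1 - N)) * (?s * norm X))\<^sup>2"
    by (simp only:) (intro add_mono power_mono norm_ge_zero)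
  also have "\<dots> = ((norm (E ** (mat 1 - N)))\<^sup>2 + (norm (E ** N))\<^sup>2) * (?s * norm X)\<^sup>2"
    by (simp add: power_mult_distrib algebra_simps)
  also have "\<dots> = (?s * norm E * norm X)\<^sup>2"
    unfolding norm_split by (simp add: power_mult_distrib mult_ac)
  finally show "(norm (?U - ?V))\<^sup>2 \<le> (?s * norm E * norm X)\<^sup>2" .
qed simp

end

section \<open>Error estimates\<close>

lemma norm_matrix_mult_le:
  fixes M :: "complex^'n^'m"
  assumes "norm M \<le> a" "norm N \<le> b"
  shows "norm (M ** N) \<le> a * b"
  using assms order_trans[OF norm_ge_zero assms(1)]
  by (intro order_trans[OF norm_matrix_mult] mult_mono) simp_all

lemma norm_add_le: "norm x \<le> a \<Longrightarrow> norm y \<le> b \<Longrightarrow> norm (x + y) \<le> a + b"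
  and norm_diff_le: "norm x \<le> a \<Longrightarrow> norm y \<le> b \<Longrightarrow> norm (x - y) \<le> a + b"
  for x y :: "'a::real_normed_vector"
  by (meson add_mono norm_triangle_ineq order_trans, meson add_mono norm_triangle_ineq4 order_trans)

lemmas norm_bounds = norm_add_le norm_diff_le norm_matrix_mult_le

section \<open>First-order part and remainder\<close>

context lse_data
begin

text \<open>The error identity with solution, residual and multiplier replaced by their unperturbed
  values, grouped so that \<open>norm_paired_terms\<close> applies to the differences containing
  \<open>N\<close>.\<close>

definition first_order ::
  "complex^'d^'q \<Rightarrow> complex^'d^'n \<Rightarrow> complex^'n^'q \<Rightarrow> complex^'d^'q \<Rightarrow> complex^'n^'r \<Rightarrow> complex^'d^'r
    \<Rightarrow> complex^'d^'n" where
  "first_order B X \<Delta>A \<Delta>B \<Delta>C \<Delta>D =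
     L ** \<Delta>D + (N ** (\<Delta>C\<^sup>H ** (L\<^sup>H ** X)) - L ** (\<Delta>C ** X))
     + (G ** \<Delta>B + (N ** (\<Delta>A\<^sup>H ** (G\<^sup>H ** X)) - G ** (\<Delta>A ** X)))
     + G ** (G\<^sup>H ** (\<Delta>A\<^sup>H ** (B - A ** X) - \<Delta>C\<^sup>H ** ((A ** L)\<^sup>H ** (B - A ** X))))"

text \<open>Each kernel term is absorbed by its partner through \<open>norm_paired_terms\<close>, so
  it adds nothing to the bound.\<close>

lemma norm_first_order_le:
  assumes X: "lse_solution A B C D X"
  shows "norm (first_order B X \<Delta>A \<Delta>B \<Delta>C \<Delta>D) \<le>
    spectral_norm L * (norm \<Delta>D + norm \<Delta>C * norm X)
    + spectral_norm G * (norm \<Delta>B + norm \<Delta>A * norm X)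
    + (spectral_norm G)\<^sup>2 * (norm \<Delta>A + norm \<Delta>C * spectral_norm (A ** L)) * norm (B - A ** X)"
proof -
  define R where "R = B - A ** X"
  have NX: "N ** X = 0"
    using lse_solution_kernel[OF X A_N C_N] by (simp add: N_hermitian)
  have "norm (\<Delta>A\<^sup>H ** R) \<le> norm \<Delta>A * norm R"
    using norm_matrix_mult[of "\<Delta>A\<^sup>H" R] by simp
  moreover have "norm (\<Delta>C\<^sup>H ** ((A ** L)\<^sup>H ** R)) \<le> norm \<Delta>C * (spectral_norm (A ** L) * norm R)"
    using norm_matrix_mult_spectral[of "(A ** L)\<^sup>H" R] norm_matrix_mult_le[of "\<Delta>C\<^sup>H"]
    by (metis norm_conj_transpose order_refl spectral_norm_conj_transpose)
  ultimately have inner: "norm (\<Delta>A\<^sup>H ** R - \<Delta>C\<^sup>H ** ((A ** L)\<^sup>H ** R))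
      \<le> norm \<Delta>A * norm R + norm \<Delta>C * (spectral_norm (A ** L) * norm R)"
    by (rule norm_diff_le)
  have "norm (G ** (G\<^sup>H ** Z)) \<le> spectral_norm G * (spectral_norm G * norm Z)" for Z :: "complex^'d^'n"
    using norm_matrix_mult_spectral[of "G\<^sup>H" Z] norm_matrix_mult_spectral[of G "G\<^sup>H ** Z"]
    by (smt (verit) mult_left_mono spectral_norm_conj_transpose spectral_norm_nonneg)
  also note mult_left_mono[OF mult_left_mono[OF inner spectral_norm_nonneg] spectral_norm_nonneg]
  finally have "norm (G ** (G\<^sup>H ** (\<Delta>A\<^sup>H ** R - \<Delta>C\<^sup>H ** ((A ** L)\<^sup>H ** R))))
      \<le> spectral_norm G * (spectral_norm G * (norm \<Delta>A * norm R + norm \<Delta>C * (spectral_norm (A ** L) * norm R)))" .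
  then have "norm (first_order B X \<Delta>A \<Delta>B \<Delta>C \<Delta>D) \<le>
      spectral_norm L * norm \<Delta>D + spectral_norm L * norm \<Delta>C * norm X
      + (spectral_norm G * norm \<Delta>B + spectral_norm G * norm \<Delta>A * norm X)
      + spectral_norm G * (spectral_norm G * (norm \<Delta>A * norm R + norm \<Delta>C * (spectral_norm (A ** L) * norm R)))"
    unfolding first_order_def R_def[symmetric]
    by (intro norm_add_le norm_matrix_mult_spectral norm_paired_terms NX N_L N_G)
  then show ?thesis
    by (simp add: R_def power2_eq_square algebra_simps)
qed

text \<open>The numerical constants come from crude estimates and have no significance.\<close>

lemma remainder_le:
  assumes X: "lse_solution A B C D X"
    and X': "lse_solution (A + \<Delta>A) (B + \<Delta>B) (C + \<Delta>C) (D + \<Delta>D) X'"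
    and C: "C ** Cp = mat 1" and C': "(C + \<Delta>C) ** moore_penrose (C + \<Delta>C) = mat 1"
    and rank: "rank ((A + \<Delta>A) ** lse_data.P (C + \<Delta>C)) = rank (A ** P)"
    and k: "1 \<le> k" "norm A \<le> k" "norm B \<le> k" "norm X \<le> k" "norm G \<le> k" "norm L \<le> k"
      "norm Cp \<le> k" "norm N \<le> k"
    and e: "0 \<le> e" "56 * (k ^ 7 * e) \<le> 1"
    and \<Delta>: "norm \<Delta>A \<le> k * e" "norm \<Delta>B \<le> k * e" "norm \<Delta>C \<le> k * e" "norm \<Delta>D \<le> k * e"
  shows "norm (X' - X - first_order B X \<Delta>A \<Delta>B \<Delta>C \<Delta>D) \<le> 400 * k ^ 13 * e\<^sup>2"
proof -
  have pw: "k ^ i * u \<le> k ^ j * u" if "i \<le> j" "0 \<le> u" for i j u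
    using k(1) that by (intro mult_right_mono power_increasing)
  have G_conj: "norm (G\<^sup>H) \<le> k" and Cp_conj: "norm (Cp\<^sup>H) \<le> k"
    and A_conj: "norm (A\<^sup>H) \<le> k" and \<Delta>A_conj: "norm (\<Delta>A\<^sup>H) \<le> k * e" and \<Delta>C_conj: "norm (\<Delta>C\<^sup>H) \<le> k * e"
    using k \<Delta> by simp_all
  have small: "56 * (k ^ i * e) \<le> 1" if "i \<le> 7" for i
    using pw[OF that e(1)] e(2) by linarith

  \<comment> \<open>Smallness of the error \<open>x\<close> is not yet known; the estimates carry it
    inside \<open>y\<close> until it can be absorbed.\<close>
  define x y where "x = norm (X' - X)" and "y = 1 + x"
  define R R' where "R = B - A ** X" and "R' = B + \<Delta>B - (A + \<Delta>A) ** X'"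
  define \<Lambda> \<Lambda>' where "\<Lambda> = Cp\<^sup>H ** (A\<^sup>H ** R)"
    and "\<Lambda>' = (moore_penrose (C + \<Delta>C))\<^sup>H ** ((A + \<Delta>A)\<^sup>H ** R')"
  define S where "S = L ** \<Delta>C + G ** \<Delta>A"
  have y: "1 \<le> y" "0 \<le> y" "0 \<le> x"
    by (simp_all add: y_def x_def)
  have ey: "e \<le> e * y" "0 \<le> e * y"
    using e(1) y mult_left_mono[of 1 y e] by simp_all

  have \<Lambda>'_eq: "(A + \<Delta>A)\<^sup>H ** R' = (C + \<Delta>C)\<^sup>H ** \<Lambda>'"
    using lse_solution_multiplier[OF X'] by (simp add: R'_def \<Lambda>'_def)
  have "(C ** Cp)\<^sup>H = mat 1"
    unfolding C by simp
  then have Cp_C: "Cp\<^sup>H ** C\<^sup>H = mat 1"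
    by (simp add: conj_transpose_mult)
  \<comment> \<open>Expressing \<open>\<Lambda>'\<close> through the unperturbed \<open>Cp\<close>
    spares any bound on the perturbed pseudoinverse; the \<open>\<Lambda>'\<close> on the right will
    be absorbed.\<close>
  have "Cp\<^sup>H ** ((A + \<Delta>A)\<^sup>H ** R') = Cp\<^sup>H ** C\<^sup>H ** \<Lambda>' + Cp\<^sup>H ** (\<Delta>C\<^sup>H ** \<Lambda>')"
    unfolding \<Lambda>'_eq by (simp add: conj_transpose_add matrix_distribs matrix_mul_assoc)
  then have \<Lambda>'_fix: "\<Lambda>' = Cp\<^sup>H ** ((A + \<Delta>A)\<^sup>H ** R' - \<Delta>C\<^sup>H ** \<Lambda>')"
    by (simp add: Cp_C matrix_distribs)
  have R_diff: "R' - R = \<Delta>B - \<Delta>A ** X' - A ** (X' - X)"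
    by (simp add: R_def R'_def matrix_distribs)
  have \<Lambda>_diff: "\<Lambda>' - \<Lambda> = Cp\<^sup>H ** (\<Delta>A\<^sup>H ** R' + A\<^sup>H ** (R' - R) - \<Delta>C\<^sup>H ** \<Lambda>')"
    by (subst \<Lambda>'_fix) (simp add: \<Lambda>_def conj_transpose_add matrix_distribs)
  have \<Lambda>_eq: "(A ** L)\<^sup>H ** R = \<Lambda>"
  proof -
    have "A\<^sup>H ** R = C\<^sup>H ** (Cp\<^sup>H ** (A\<^sup>H ** R))"
      using lse_solution_multiplier[OF X] by (simp add: R_def)
    from L_conj[OF this] show ?thesis
      by (simp add: \<Lambda>_def conj_transpose_mult matrix_mul_assoc)
  qed

  have S_le: "norm S \<le> 2 * (k\<^sup>2 * e)"
  proof -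
    have "norm S \<le> k * (k * e) + k * (k * e)"
      unfolding S_def by (intro norm_bounds k \<Delta>)
    then show ?thesis by (simp add: power2_eq_square algebra_simps)
  qed
  then have S_half: "norm S \<le> 1 / 2"
    using small[of 2] by simp
  obtain W where W: "(A + \<Delta>A) ** W = 0" "(C + \<Delta>C) ** W = 0" "W = N - S ** W"
  proof (rule kernel_matrix_lift[OF C C' rank])
    show "norm (L ** (C + \<Delta>C - C) + G ** (A + \<Delta>A - A)) < 1"
      using S_half by (simp add: S_def)
  qed (simp add: S_def)
  have W_le: "norm W \<le> 2 * k"
  proof -
    have "norm W \<le> k + 1 / 2 * norm W"
      by (subst W(3)) (intro norm_bounds k S_half order_refl)
    then show ?thesis by simp
  qed
  note NX' = kernel_component_identity[OF X' W]

  have X'_le: "norm X' \<le> k * y"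
  proof -
    have "norm X' \<le> x + k"
      using norm_add_le[of "X' - X" x X k] k(4) by (simp add: x_def)
    moreover have "x \<le> k * x"
      using mult_right_mono[OF k(1) y(3)] by simp
    ultimately show ?thesis by (simp add: y_def algebra_simps)
  qed
  have ke: "k * e \<le> k" "k * e \<le> 1"
    using small[of 1] k(1) unfolding power_one_right by linarith+
  have A'_le: "norm ((A + \<Delta>A)\<^sup>H) \<le> 2 * k"
    using norm_add_le[OF k(2) \<Delta>(1)] ke by simp
  have R'_le: "norm R' \<le> 4 * (k\<^sup>2 * y)"
  proof -
    have "norm R' \<le> (k + k * e) + 2 * k * (k * y)"
      unfolding R'_def using A'_le by (intro norm_bounds k \<Delta> X'_le) simp
    also have "2 * k * (k * y) = 2 * (k\<^sup>2 * y)"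
      by (simp add: power2_eq_square)
    also have "k + k * e \<le> 2 * (k\<^sup>2 * y)"
      using ke(1) mult_left_mono[OF y(1), of k] k(1) pw[of 1 2 y] y(2)
      unfolding power_one_right mult_1_right by linarith
    finally show ?thesis
      by linarith
  qed
  have \<Lambda>'_le: "norm \<Lambda>' \<le> 16 * (k ^ 4 * y)"
  proof -
    have "norm \<Lambda>' \<le> k * (2 * k * (4 * (k\<^sup>2 * y)) + k * e * norm \<Lambda>')"
      by (subst \<Lambda>'_fix) (intro norm_bounds Cp_conj A'_le R'_le \<Delta>C_conj order_refl)
    also have "\<dots> = 8 * (k ^ 4 * y) + k\<^sup>2 * e * norm \<Lambda>'"
      by (simp add: power2_eq_square power4_eq_xxxx algebra_simps)
    also have "k\<^sup>2 * e * norm \<Lambda>' \<le> 1 / 2 * norm \<Lambda>'"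
      using small[of 2] by (intro mult_right_mono) simp_all
    finally show ?thesis by linarith
  qed
  have SX'_le: "norm (S\<^sup>H ** X') \<le> 2 * (k ^ 3 * (e * y))"
  proof -
    have "norm (S\<^sup>H ** X') \<le> 2 * (k\<^sup>2 * e) * (k * y)"
      using S_le by (intro norm_bounds X'_le) simp
    then show ?thesis by (simp add: power2_eq_square power3_eq_cube algebra_simps)
  qed
  have NX'_le: "norm (N ** X') \<le> 4 * (k ^ 4 * (e * y))"
  proof -
    have "norm (N ** X') \<le> k * (2 * (k ^ 3 * (e * y))) + 2 * k * (1 / 2 * (2 * (k ^ 3 * (e * y))))"
      unfolding NX' using S_half W_le by (intro norm_bounds k SX'_le) simp_all
    then show ?thesis by (simp add: power3_eq_cube power4_eq_xxxx algebra_simps)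
  qed
  note identity = error_identity[OF X X' R'_def \<Lambda>'_eq]
  \<comment> \<open>The estimate takes the form \<open>x \<le> 28 * k ^ 7 * e * (1 + x)\<close>. The
    factor 56 in the hypothesis makes the coefficient of \<open>x\<close> at most 1/2.\<close>
  have x_le: "x \<le> 56 * (k ^ 7 * e)"
  proof -
    have "x \<le> k * (k * e + k * e * (k * y)) + k * (k * e + k * e * (k * y))
      + k * k * (k * e * (4 * (k\<^sup>2 * y)) + k * e * (16 * (k ^ 4 * y))) + 4 * (k ^ 4 * (e * y))"
      unfolding x_def identity
      by (intro norm_bounds k \<Delta> X'_le R'_le \<Lambda>'_le \<Delta>A_conj \<Delta>C_conj G_conj NX'_le)
    also have "\<dots> = 2 * (k ^ 2 * e) + 2 * (k ^ 3 * (e * y)) + 4 * (k ^ 5 * (e * y))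
        + 16 * (k ^ 7 * (e * y)) + 4 * (k ^ 4 * (e * y))"
      by algebra
    also have "\<dots> \<le> 28 * (k ^ 7 * (e * y))"
    proof -
      have "k ^ 7 * e \<le> k ^ 7 * (e * y)"
        using ey(1) k(1) by (intro mult_left_mono) simp_all
      then show ?thesis
        using pw[of 2 7 e] pw[of 3 7 "e * y"] pw[of 5 7 "e * y"] pw[of 4 7 "e * y"] ey(2) e(1) by linarith
    qed
    also have "\<dots> = 28 * (k ^ 7 * e) + 28 * (k ^ 7 * e) * x"
      by (simp add: y_def algebra_simps)
    also have "28 * (k ^ 7 * e) * x \<le> 1 / 2 * x"
      using e(2) y(3) by (intro mult_right_mono) simp_all
    finally show ?thesis by linarith
  qed
  \<comment> \<open>With \<open>y\<close> bounded, the earlier estimates no longer involve the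
    unknown error.\<close>
  then have "y \<le> 2"
    using e(2) by (simp add: y_def)
  then have k_y: "k ^ i * y \<le> k ^ i * 2" and k_e_y: "k ^ i * (e * y) \<le> k ^ i * (e * 2)" for i
    using k(1) e(1) by (intro mult_left_mono; simp)+
  have X'_le: "norm X' \<le> 2 * k" and R'_le: "norm R' \<le> 8 * k\<^sup>2" and \<Lambda>'_le: "norm \<Lambda>' \<le> 32 * k ^ 4"
    and SX'_le: "norm (S\<^sup>H ** X') \<le> 4 * (k ^ 3 * e)"
    using X'_le R'_le \<Lambda>'_le SX'_le k_y[of 1] k_y[of 2] k_y[of 4] k_e_y[of 3] by simp_all
  have \<Delta>X_le: "norm (X' - X) \<le> 56 * (k ^ 7 * e)"
    using x_le by (simp add: x_def)
  have R_diff_le: "norm (R' - R) \<le> 59 * (k ^ 8 * e)"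
  proof -
    have "norm (R' - R) \<le> k * e + k * e * (2 * k) + k * (56 * (k ^ 7 * e))"
      unfolding R_diff by (intro norm_bounds k \<Delta> X'_le \<Delta>X_le)
    also have "\<dots> = k ^ 1 * e + 2 * (k ^ 2 * e) + 56 * (k ^ 8 * e)"
      by algebra
    finally show ?thesis
      using pw[of 1 8 e] pw[of 2 8 e] e(1) by linarith
  qed
  have \<Lambda>_diff_le: "norm (\<Lambda>' - \<Lambda>) \<le> 99 * (k ^ 10 * e)"
  proof -
    have "norm (\<Lambda>' - \<Lambda>) \<le> k * (k * e * (8 * k\<^sup>2) + k * (59 * (k ^ 8 * e)) + k * e * (32 * k ^ 4))"
      unfolding \<Lambda>_diff by (intro norm_bounds Cp_conj \<Delta>A_conj \<Delta>C_conj A_conj R'_le R_diff_le \<Lambda>'_le)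
    also have "\<dots> = 8 * (k ^ 4 * e) + 59 * (k ^ 10 * e) + 32 * (k ^ 6 * e)"
      by algebra
    finally show ?thesis
      using pw[of 4 10 e] pw[of 6 10 e] e(1) by linarith
  qed
  \<comment> \<open>Subtracting the unperturbed values leaves only terms with two small
    factors.\<close>
  have "X' - X - first_order B X \<Delta>A \<Delta>B \<Delta>C \<Delta>D =
      G ** (G\<^sup>H ** (\<Delta>A\<^sup>H ** (R' - R) - \<Delta>C\<^sup>H ** (\<Lambda>' - \<Lambda>)))
      - L ** (\<Delta>C ** (X' - X)) - G ** (\<Delta>A ** (X' - X))
      + N ** (S\<^sup>H ** (X' - X)) - W\<^sup>H ** (S\<^sup>H ** (S\<^sup>H ** X'))"
  proof -
    have first: "first_order B X \<Delta>A \<Delta>B \<Delta>C \<Delta>D = L ** (\<Delta>D - \<Delta>C ** X) + G ** (\<Delta>B - \<Delta>A ** X)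
        + G ** G\<^sup>H ** (\<Delta>A\<^sup>H ** R - \<Delta>C\<^sup>H ** \<Lambda>) + N ** (S\<^sup>H ** X)"
      unfolding first_order_def R_def[symmetric] \<Lambda>_eq
      by (simp add: S_def conj_transpose_add conj_transpose_mult matrix_distribs matrix_mul_assoc)
    show ?thesis
      unfolding first
      by (subst (1) identity, subst NX') (simp add: matrix_distribs matrix_mul_assoc)
  qed
  also have "norm \<dots> \<le> k * (k * (k * e * (59 * (k ^ 8 * e)) + k * e * (99 * (k ^ 10 * e))))
      + k * (k * e * (56 * (k ^ 7 * e))) + k * (k * e * (56 * (k ^ 7 * e)))
      + k * (2 * (k\<^sup>2 * e) * (56 * (k ^ 7 * e))) + 2 * k * (2 * (k\<^sup>2 * e) * (4 * (k ^ 3 * e)))"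
    using S_le W_le
    by (intro norm_bounds k \<Delta> G_conj \<Delta>A_conj \<Delta>C_conj R_diff_le \<Lambda>_diff_le \<Delta>X_le SX'_le) simp_all
  also have "\<dots> = 59 * (k ^ 11 * e\<^sup>2) + 99 * (k ^ 13 * e\<^sup>2) + 112 * (k ^ 9 * e\<^sup>2)
      + 112 * (k ^ 10 * e\<^sup>2) + 16 * (k ^ 6 * e\<^sup>2)"
    by algebra
  \<comment> \<open>The coefficients add up to 398.\<close>
  also have "\<dots> \<le> 400 * (k ^ 13 * e\<^sup>2)"
  proof -
    have "k ^ 11 * e\<^sup>2 \<le> k ^ 13 * e\<^sup>2" "k ^ 9 * e\<^sup>2 \<le> k ^ 13 * e\<^sup>2"
      "k ^ 10 * e\<^sup>2 \<le> k ^ 13 * e\<^sup>2" "k ^ 6 * e\<^sup>2 \<le> k ^ 13 * e\<^sup>2"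
      by (intro pw; simp)+
    moreover have "0 \<le> k ^ 13 * e\<^sup>2"
      using k(1) by (intro mult_nonneg_nonneg) simp_all
    ultimately show ?thesis by linarith
  qed
  finally show ?thesis by simp
qed

end

text \<open>\<open>\<delta>\<close> and \<open>g\<close> are fixed before the perturbations, so the
  remainder is uniform. Equal ranks accompany \<open>\<epsilon> < \<delta>\<close> because an
  arbitrarily small change that raises the rank can make the solution unbounded.\<close>

theorem theorem4p2:
  fixes A :: "rbq^'n^'m" and B :: "rbq^'d^'m" and C :: "rbq^'n^'p" and D :: "rbq^'d^'p"
    and X :: "complex^'d^'n"
  assumes "CARD('m) \<ge> CARD('n) + CARD('d)"
    and "full_row_rank (block_column C)"
    and "complex_solution A B C D X"
  shows "\<exists>\<delta>>0. \<exists>g \<in> O[at_right 0](\<lambda>\<epsilon>. \<epsilon>\<^sup>2).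
    \<forall>(\<Delta>A :: rbq^'n^'m) (\<Delta>B :: rbq^'d^'m) (\<Delta>C :: rbq^'n^'p) (\<Delta>D :: rbq^'d^'p)
      (\<epsilon> :: real) (X' :: complex^'d^'n).
      full_row_rank (block_column (C + \<Delta>C)) \<longrightarrow>
      smallest_perturbation_bound A B C D \<Delta>A \<Delta>B \<Delta>C \<Delta>D \<epsilon> \<longrightarrow>
      complex_solution (A + \<Delta>A) (B + \<Delta>B) (C + \<Delta>C) (D + \<Delta>D) X' \<longrightarrow>
      \<epsilon> < \<delta> \<longrightarrow>
      rank (block_column (A + \<Delta>A) ** P_c (C + \<Delta>C)) = rank (block_column A ** P_c C) \<longrightarrow>
      frobenius_norm (X' - X) / frobenius_norm X \<le>
        \<epsilon> * (K_A A C *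
               (frobenius_norm (block_column D) /
                  (frobenius_norm (block_column C) * frobenius_norm X) + 1)
           + K_B A C *
               (frobenius_norm (block_column B) /
                  (frobenius_norm (block_column A) * frobenius_norm X) + 1)
           + (K_B A C)\<^sup>2 *
               (frobenius_norm (block_column C) / frobenius_norm (block_column A) *
                  spectral_norm (block_column A ** L_c A C) + 1) *
               (frobenius_norm (R_c A B X) /
                  (frobenius_norm (block_column A) * frobenius_norm X)))
        + g \<epsilon>"
proof -
  define a b c d where "a = block_column A" and "b = block_column B"
    and "c = block_column C" and "d = block_column D"
  interpret lse_data a c .
  have P: "lse_data.P (block_column E) = P_c E" for E :: "rbq^'n^'p"
    by (simp add: lse_data.P_def P_c_def)
  have P_c: "P_c C = P"
    using P[of C] by (simp add: c_def)
  have G: "moore_penrose (a ** P_c C) = G" and L: "L_c A C = L"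
    by (simp_all add: P_c G_def L_def L_c_def flip: a_def c_def)
  have sol: "lse_solution a b c d X"
    unfolding a_def b_def c_def d_def by (rule lse_solution_block_column[OF assms(3)])
  have right_inv: "c ** Cp = mat 1"
    using full_row_rank_right_inverse[OF assms(2)] by (simp add: c_def)
  \<comment> \<open>Positivity of \<open>norm c\<close> later yields
    \<open>0 \<le> \<epsilon>\<close> and cancels a denominator.\<close>
  have "c \<noteq> 0"
  proof
    assume "c = 0"
    then have "mat 1 = (0 :: complex^('p + 'p)^('p + 'p))"
      using right_inv by simp
    then have "mat 1 $ i $ i = (0 :: complex^('p + 'p)^('p + 'p)) $ i $ i" for i
      by simp
    then show False by (simp add: mat_def)
  qed
  then have c_pos: "norm c > 0" by simp

  \<comment> \<open>A single constant dominating all unperturbed quantities, independent of the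
    perturbations.\<close>
  define k where "k = 1 + norm a + norm b + norm c + norm d + norm X + norm G + norm L + norm Cp + norm N"
  have k: "1 \<le> k" "norm a \<le> k" "norm b \<le> k" "norm X \<le> k" "norm G \<le> k" "norm L \<le> k"
    "norm Cp \<le> k" "norm N \<le> k" and k': "norm c \<le> k" "norm d \<le> k"
    by (simp_all add: k_def)
  define sL sG sAL r x where "sL = spectral_norm L" and "sG = spectral_norm G"
    and "sAL = spectral_norm (a ** L)" and "r = norm (b - a ** X)" and "x = norm X"
  have nonneg: "0 \<le> sL" "0 \<le> sG" "0 \<le> sAL" "0 \<le> r" "0 \<le> x"
    by (simp_all add: sL_def sG_def sAL_def r_def x_def)
  define F where "F = norm c * sL * (norm d / (norm c * x) + 1)
    + norm a * sG * (norm b / (norm a * x) + 1)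
    + (norm a * sG)\<^sup>2 * (norm c / norm a * sAL + 1) * (r / (norm a * x))"
  have F_nonneg: "0 \<le> F"
    unfolding F_def using nonneg
    by (intro add_nonneg_nonneg mult_nonneg_nonneg divide_nonneg_nonneg) simp_all
  have F_eq: "F * x = sL * (norm d + norm c * x) + sG * (norm b + norm a * x)
      + sG\<^sup>2 * (norm a + norm c * sAL) * r" if "x \<noteq> 0"
  proof -
    have "norm c * sL * (norm d / (norm c * x) + 1) * x = sL * (norm d + norm c * x)"
      using that c_pos by (simp add: field_simps)
    moreover have "norm a * sG * (norm b / (norm a * x) + 1) * x = sG * (norm b + norm a * x)"
      "(norm a * sG)\<^sup>2 * (norm c / norm a * sAL + 1) * (r / (norm a * x)) * x
        = sG\<^sup>2 * (norm a + norm c * sAL) * r"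
    proof -
      \<comment> \<open>For \<open>a = 0\<close> the factor \<open>norm a\<close> cannot be
        cancelled, but both sides vanish with \<open>G\<close>.\<close>
      have "sG = 0" if "a = 0"
        unfolding sG_def G_def by (simp add: that)
      then show "norm a * sG * (norm b / (norm a * x) + 1) * x = sG * (norm b + norm a * x)"
        "(norm a * sG)\<^sup>2 * (norm c / norm a * sAL + 1) * (r / (norm a * x)) * x
          = sG\<^sup>2 * (norm a + norm c * sAL) * r"
        using that by (cases "a = 0"; simp add: field_simps power2_eq_square)+
    qed
    ultimately show ?thesis
      by (simp only: F_def distrib_right)
  qed

  define g where "g = (\<lambda>\<epsilon>::real. 400 * k ^ 13 / x * \<epsilon>\<^sup>2)"
  \<comment> \<open>The threshold on \<open>\<epsilon>\<close> is the smallness hypothesis of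
    \<open>remainder_le\<close> solved for \<open>e\<close>.\<close>
  have main: "norm (X' - X) / x \<le> \<epsilon> * F + g \<epsilon>"
    if rank': "full_row_rank (block_column (C + \<Delta>C))"
      and small: "smallest_perturbation_bound A B C D \<Delta>A \<Delta>B \<Delta>C \<Delta>D \<epsilon>"
      and sol': "complex_solution (A + \<Delta>A) (B + \<Delta>B) (C + \<Delta>C) (D + \<Delta>D) X'"
      and \<epsilon>: "\<epsilon> < 1 / (56 * k ^ 7)"
      and rank: "rank (block_column (A + \<Delta>A) ** P_c (C + \<Delta>C)) = rank (block_column A ** P_c C)"
    for \<Delta>A \<Delta>B \<Delta>C \<Delta>D \<epsilon> X'
  proof -
    define a' b' c' d' where "a' = block_column \<Delta>A" and "b' = block_column \<Delta>B"
      and "c' = block_column \<Delta>C" and "d' = block_column \<Delta>D"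
    have \<Delta>: "norm a' \<le> \<epsilon> * norm a" "norm b' \<le> \<epsilon> * norm b" "norm c' \<le> \<epsilon> * norm c" "norm d' \<le> \<epsilon> * norm d"
      using small by (simp_all add: smallest_perturbation_bound_def perturbation_bound_def norm_block_column
          a_def b_def c_def d_def a'_def b'_def c'_def d'_def)
    have "0 \<le> \<epsilon> * norm c"
      using \<Delta>(3) norm_ge_zero order_trans by blast
    then have \<epsilon>0: "0 \<le> \<epsilon>"
      using c_pos by (simp add: zero_le_mult_iff)
    have scale: "\<epsilon> * u \<le> k * \<epsilon>" if "u \<le> k" for u
      using mult_left_mono[OF that \<epsilon>0] by (simp add: mult.commute)
    note \<Delta>k = \<Delta>[THEN order_trans, OF scale]
    have rem: "norm (X' - X - first_order b X a' b' c' d') \<le> 400 * k ^ 13 * \<epsilon>\<^sup>2"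
    proof (rule remainder_le[OF sol _ right_inv _ _ k \<epsilon>0])
      show "lse_solution (a + a') (b + b') (c + c') (d + d') X'"
        using lse_solution_block_column[OF sol']
        by (simp add: block_column_add a_def b_def c_def d_def a'_def b'_def c'_def d'_def)
      show "(c + c') ** moore_penrose (c + c') = mat 1"
        using full_row_rank_right_inverse[OF rank'] by (simp add: block_column_add c_def c'_def)
      show "rank ((a + a') ** lse_data.P (c + c')) = rank (a ** P)"
        using rank P[of C] P[of "C + \<Delta>C"] by (simp add: block_column_add a_def a'_def c_def c'_def)
      show "56 * (k ^ 7 * \<epsilon>) \<le> 1"
        using \<epsilon> k(1) by (simp add: field_simps)
    qed (use \<Delta>k k k' in simp_all)
    show ?thesis
    proof (cases "x = 0")
      \<comment> \<open>Division by zero gives 0 on the left and in \<open>g\<close>; the remaining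
        term is nonnegative.\<close>
      case True
      then show ?thesis using F_nonneg \<epsilon>0 by (simp add: g_def)
    next
      case False
      have "norm (first_order b X a' b' c' d') \<le> sL * (norm d' + norm c' * x)
          + sG * (norm b' + norm a' * x) + sG\<^sup>2 * (norm a' + norm c' * sAL) * r"
        unfolding sL_def sG_def sAL_def r_def x_def by (rule norm_first_order_le[OF sol])
      also have "\<dots> \<le> sL * (\<epsilon> * norm d + \<epsilon> * norm c * x)
          + sG * (\<epsilon> * norm b + \<epsilon> * norm a * x) + sG\<^sup>2 * (\<epsilon> * norm a + \<epsilon> * norm c * sAL) * r"
        by (intro add_mono mult_left_mono mult_right_mono \<Delta> nonneg zero_le_power2)
      also have "\<dots> = \<epsilon> * (F * x)"
        unfolding F_eq[OF False] by (simp add: algebra_simps)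
      finally have "norm (X' - X) \<le> \<epsilon> * (F * x) + 400 * k ^ 13 * \<epsilon>\<^sup>2"
        using rem norm_triangle_sub[of "X' - X" "first_order b X a' b' c' d'"] by linarith
      then show ?thesis
        using False nonneg(5) by (simp add: g_def field_simps)
    qed
  qed
  have eqs: "K_A A C = norm c * sL" "K_B A C = norm a * sG"
    "frobenius_norm (R_c A B X) = r" "frobenius_norm X = x"
    "spectral_norm (block_column A ** L_c A C) = sAL"
    "frobenius_norm (block_column A) = norm a" "frobenius_norm (block_column B) = norm b"
    "frobenius_norm (block_column C) = norm c" "frobenius_norm (block_column D) = norm d"
    "frobenius_norm (X' - X) = norm (X' - X)" for X'
    using G L by (simp_all add: K_A_def K_B_def R_c_def frobenius_norm_eq_norm a_def b_def c_def d_def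
        sL_def sG_def sAL_def r_def x_def)
  have "g \<in> O[at_right 0](\<lambda>\<epsilon>. \<epsilon>\<^sup>2)"
    by (rule bigoI[of _ "\<bar>400 * k ^ 13 / x\<bar>"]) (simp add: g_def abs_mult)
  moreover have "0 < 1 / (56 * k ^ 7)"
    using k(1) by simp
  ultimately show ?thesis
    unfolding eqs F_def[symmetric] using main by blast
qed

end
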